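(* Let $Q$ be a set endowed with two binary operations $\lhd$ and $\diamond$. Consider the following $Q$-coloring rules for diagrams of well-oriented knotted $3$-valent graphs. (A) At each crossing, if the over-arc has color $b$ and the under-arc lying to the right of the over-arc (with respect to the orientation of the over-arc) has color $a$, then the under-arc lying to the left of the over-arc has color $a\lhd b$. (B) At each $3$-valent vertex, drawn so that the edges flow from the top to the bottom of the page: at a zip vertex with incoming arcs colored $a$ (top left) and $b$ (top right), the outgoing (bottom) arc has color $a\diamond b$; at an unzip vertex with outgoing arcs colored $a$ (bottom left) and $b$ (bottom right), the incoming (top) arc has color $a\diamond b$. These coloring rules are topological if and only if $(Q,\lhd,\diamond)$ is a qualgebra.
   Context: **Graphs and diagrams.** A knotted $3$-valent graph is an embedding of an abstract $3$-valent graph into $\mathbb{R}^3$; diagrams are its generic projections to $\mathbb{R}^2$ with over/under information at crossings. An oriented $3$-valent graph is well-oriented if each vertex is a zip vertex (two incoming edges, one outgoing) or an unzip vertex (one incoming edge, two outgoing). The special points of a diagram are its crossings and its $3$-valent vertices. An arc is a part of the diagram delimited by special points, where the over-strand is not cut at a crossing (so it carries one color through the crossing). A sub-diagram is a part of a diagram contained in a disc, e.g. either side of an R-move. **R-moves.** These are the local moves: I, II, III (the usual Reidemeister moves); IV (a strand passing under a $3$-valent vertex is moved from one side of the vertex to the other); V (a crossing between two edges adjacent to a vertex, located next to this vertex, is added or removed); VI (a strand passing over a $3$-valent vertex is moved from one side of the vertex to the other). All these moves are considered with all orientations for which the diagrams involved are well-oriented. **Colorings.** For a set $Q$ with coloring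 rules, a $Q$-coloring of a (sub-)diagram $D$ is a map from the set of arcs of $D$ to $Q$ satisfying the coloring rules around all special points. Coloring rules are called topological if for any (sub-)diagram $D$, any $Q$-coloring $\mathcal{C}$ of $D$, and any $D'$ obtained from $D$ by applying one R-move, there exists a unique $Q$-coloring $\mathcal{C}'$ of $D'$ coinciding with $\mathcal{C}$ outside the small ball where the R-move is performed. **Qualgebras.** $(Q,\lhd,\diamond)$ is a qualgebra if there is a (necessarily unique) binary operation $\widetilde{\lhd}$ on $Q$ such that for all $a,b,c\in Q$: $(a\lhd b)\lhd c=(a\lhd c)\lhd(b\lhd c)$; $(a\lhd b)\,\widetilde{\lhd}\, b=(a\,\widetilde{\lhd}\, b)\lhd b=a$; $a\lhd a=a$; $a\lhd(b\diamond c)=(a\lhd b)\lhd c$; $(a\diamond b)\lhd c=(a\lhd c)\diamond(b\lhd c)$; $a\diamond b=b\diamond(a\lhd b)$. *)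

theory Defs
  imports
    "HOL-Library.Multiset"
    "HOL-Library.FuncSet"
    "HOL-Combinatorics.Orbits"
    "HOL-Combinatorics.Cycles"
begin

section \<open>Diagrams of well-oriented knotted 3-valent graphs\<close>

text \<open>
  A (sub-)diagram in a disc is recorded, up to isotopy of the disc, by its combinatorial plane map:
  its oriented edges (labelled by natural numbers), the nodes at which edges meet, the
  counterclockwise order of the edge ends around every node, and the points in which the diagram
  meets the boundary circle of the disc. A whole diagram is the case of an empty boundary.

  Besides the special points (crossings and 3-valent vertices) there are nodes \<open>Joint x y\<close>:
  auxiliary subdivision points on a strand, at which edge \<open>x\<close> is continued by edge \<open>y\<close>. They are not
  special points and do not delimit arcs. They make it possible to represent components without
  special points (\<open>Joint x x\<close> is a circle) and strands that run through a ball without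
  meeting a special point there.

  \<^item> \<open>Crossing s oi oo r l\<close>: the over-strand enters by \<open>oi\<close> and leaves by \<open>oo\<close>; with respect to its
    orientation, the edge \<open>r\<close> of the under-strand lies to the right and \<open>l\<close> to the left. The
    under-strand runs from \<open>r\<close> to \<open>l\<close> if \<open>s\<close> holds, and from \<open>l\<close> to \<open>r\<close> otherwise.
  \<^item> \<open>Zip a b c\<close>: edges flowing from top to bottom, \<open>a\<close> comes in from the top left,
    \<open>b\<close> from the top right, and \<open>c\<close> goes out at the bottom.
  \<^item> \<open>Unzip a b c\<close>: edges flowing from top to bottom, \<open>c\<close> comes in from the top,
    \<open>a\<close> goes out at the bottom left and \<open>b\<close> at the bottom right.
\<close>

type_synonym edge = nat

datatype node =
    Crossing bool edge edge edge edge
  | Zip edge edge edge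
  | Unzip edge edge edge
  | Joint edge edge

text \<open>
  A dart is an end of an edge: \<open>(e, True)\<close> is the initial end of \<open>e\<close>, attached to the node that \<open>e\<close>
  leaves, and \<open>(e, False)\<close> is its final end, attached to the node that \<open>e\<close> enters.
\<close>

type_synonym dart = "edge \<times> bool"

text \<open>The darts at a node, in counterclockwise order.\<close>

fun node_darts :: "node \<Rightarrow> dart list" where
  "node_darts (Crossing s oi oo r l) = [(oo, True), (l, s), (oi, False), (r, \<not> s)]"
| "node_darts (Zip a b c) = [(a, False), (c, True), (b, False)]"
| "node_darts (Unzip a b c) = [(c, False), (a, True), (b, True)]"
| "node_darts (Joint x y) = [(x, False), (y, True)]"

text \<open>
  The field \<open>boundary\<close> lists the edge ends on the boundary circle of the disc, counterclockwise along
  the circle: \<open>(e, True)\<close> stands for an edge that starts on the circle and runs into the disc,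
  \<open>(e, False)\<close> for one that ends on the circle.
\<close>

record diagram =
  nodes :: "node list"
  boundary :: "dart list"

text \<open>
  The exterior of the disc is contracted to one more vertex of a map on the sphere. Seen from that
  vertex, the boundary points occur in the opposite cyclic order.
\<close>

definition vertex_cycles :: "diagram \<Rightarrow> dart list list" where
  "vertex_cycles D = rev (boundary D) # map node_darts (nodes D)"

definition darts :: "diagram \<Rightarrow> dart set" where
  "darts D = set (concat (vertex_cycles D))"

definition edges :: "diagram \<Rightarrow> edge set" where
  "edges D = fst ` darts D"

definition rotation :: "diagram \<Rightarrow> dart \<Rightarrow> dart" where
  "rotation D = foldr (\<circ>) (map cycle_of_list (vertex_cycles D)) id"

definition opposite :: "dart \<Rightarrow> dart" where
  "opposite d = (fst d, \<not> snd d)"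

definition vertex_orbits :: "diagram \<Rightarrow> dart set set" where
  "vertex_orbits D = orbit (rotation D) ` darts D"

definition face_orbits :: "diagram \<Rightarrow> dart set set" where
  "face_orbits D = orbit (rotation D \<circ> opposite) ` darts D"

definition components :: "diagram \<Rightarrow> dart set set" where
  "components D = (\<lambda>d. {(x, y). y = rotation D x \<or> y = opposite x}\<^sup>* `` {d}) ` darts D"

text \<open>
  Euler's formula, summed over the connected components of the map: each of them has genus 0.
  (An exterior vertex without darts is not counted on either side.)
\<close>

definition spherical :: "diagram \<Rightarrow> bool" where
  "spherical D \<longleftrightarrow>
     card (vertex_orbits D) + card (face_orbits D) = card (edges D) + 2 * card (components D)"

text \<open>Every edge has one initial and one final end, and the map is planar.\<close>

definition is_diagram :: "diagram \<Rightarrow> bool" where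
  "is_diagram D \<longleftrightarrow>
     distinct (concat (vertex_cycles D)) \<and> opposite ` darts D = darts D \<and> spherical D"


section \<open>R-moves\<close>

text \<open>
  \<open>cross p q s n e w\<close> is a crossing in a picture where the over-strand is vertical, with ends \<open>s\<close>
  (south) and \<open>n\<close> (north), and the under-strand horizontal, with ends \<open>e\<close> (east) and \<open>w\<close> (west).
  The over-strand runs northwards iff \<open>p\<close>, and the under-strand runs westwards iff \<open>q\<close>.
\<close>

definition cross :: "bool \<Rightarrow> bool \<Rightarrow> edge \<Rightarrow> edge \<Rightarrow> edge \<Rightarrow> edge \<Rightarrow> node" where
  "cross p q s n e w = (if p then Crossing q s n e w else Crossing (\<not> q) n s w e)"

text \<open>A strand without special points with ends \<open>x\<close> and \<open>y\<close>, running from \<open>x\<close> to \<open>y\<close> iff \<open>p\<close>.\<close>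

definition strand :: "bool \<Rightarrow> edge \<Rightarrow> edge \<Rightarrow> node" where
  "strand p x y = (if p then Joint x y else Joint y x)"

text \<open>
  \<open>v\<close> is a 3-valent vertex with darts \<open>d1\<close>, \<open>d2\<close>, \<open>d3\<close> counterclockwise, starting from any of them.
\<close>

definition trivalent :: "node \<Rightarrow> dart \<Rightarrow> dart \<Rightarrow> dart \<Rightarrow> bool" where
  "trivalent v d1 d2 d3 \<longleftrightarrow> (\<exists>k. rotate k (node_darts v) = [d1, d2, d3])"

text \<open>
  \<open>local_move B L L'\<close>: in a small ball, an R-move turns the nodes \<open>L\<close> into the nodes \<open>L'\<close>; the edges
  in \<open>B\<close> are the ones that cross the boundary of the ball. The other edges of \<open>L\<close> and of \<open>L'\<close> lie inside
  the ball. The Boolean parameters are the orientations of the strands, which are arbitrary. Every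
  picture may be rotated.

  \<^item> \<open>I\<close>: the edge \<open>m\<close> is the loop; the four rules are the two types of crossing
    combined with the two ways of travelling along the kink.
  \<^item> \<open>II\<close>: two vertical strands, the one from \<open>b1\<close> to \<open>t1\<close> on the left; then the right one, from
    \<open>b2\<close> to \<open>t2\<close>, is pushed to the left under the other one.
  \<^item> \<open>III\<close>: the vertical top strand (\<open>t0\<close>, \<open>t1\<close>, \<open>t2\<close> from south to north) is moved from the west to
    the east of the crossing of the middle strand (\<open>m0\<close>, \<open>m1\<close>, \<open>m2\<close> from west to east) with the
    bottom strand (\<open>b0\<close>, \<open>b1\<close>, \<open>b2\<close> from west to east). The middle strand climbs from
    west to east and the bottom strand descends in \<open>III_up\<close>, and vice versa in \<open>III_down\<close>. The
    parameters \<open>t\<close>, \<open>m\<close>, \<open>b\<close> tell whether the strands run northwards, eastwards, eastwards.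
  \<^item> \<open>IV\<close>, \<open>VI\<close>: a 3-valent vertex with edges \<open>x1\<close> to the west, \<open>x2\<close> to the south-east,
    \<open>x3\<close> to the north-east, and a vertical strand (\<open>s0\<close>, \<open>s1\<close>, \<open>s2\<close> from south to north, running
    northwards iff \<open>u\<close>) moved from the west to the east of the vertex. The flag \<open>o1\<close> tells
    whether the edge \<open>x1\<close> leaves the vertex, etc. The parts of the edges between the
    vertex and the strand are \<open>k1\<close>, \<open>k2\<close>, \<open>k3\<close>.
  \<^item> \<open>V\<close>: a 3-valent vertex with edges \<open>x1\<close> to the north-east, \<open>x2\<close> to the north-west, \<open>x3\<close> to the
    south; after the move the first two cross next to the vertex, and \<open>k1\<close>, \<open>k2\<close> are
    their parts between the vertex and the crossing. The first edge is the over-strand in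
    \<open>V_first\<close>, and the second one in \<open>V_second\<close>.
\<close>

inductive local_move :: "edge set \<Rightarrow> node list \<Rightarrow> node list \<Rightarrow> bool" where
  I_over_right: "local_move {x, y} [Joint x y] [Crossing True x m m y]"
| I_over_left: "local_move {x, y} [Joint x y] [Crossing False x m y m]"
| I_under_right: "local_move {x, y} [Joint x y] [Crossing True m y x m]"
| I_under_left: "local_move {x, y} [Joint x y] [Crossing False m y m x]"
| II: "local_move {b1, t1, b2, t2}
    [strand p b1 t1, strand q b2 t2]
    [cross p q b1 m b2 k, cross p (\<not> q) m t1 t2 k]"
| III_up: "local_move {t0, t2, m0, m2, b0, b2}
    [cross t (\<not> m) t0 t1 m1 m0, cross t (\<not> b) t1 t2 b1 b0, cross m (\<not> b) m1 m2 b2 b1]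
    [cross m (\<not> b) m0 m1' b1' b0, cross t (\<not> b) t0 t1' b2 b1', cross t (\<not> m) t1' t2 m2 m1']"
| III_down: "local_move {t0, t2, m0, m2, b0, b2}
    [cross t (\<not> b) t0 t1 b1 b0, cross t (\<not> m) t1 t2 m1 m0, cross (\<not> m) (\<not> b) m2 m1 b2 b1]
    [cross (\<not> m) (\<not> b) m1' m0 b1' b0, cross t (\<not> m) t0 t1' m2 m1', cross t (\<not> b) t1' t2 b2 b1']"
| IV: "local_move {x1, x2, x3, s0, s2}
    [v, cross (\<not> o1) u x1 k1 s0 s2]
    [v', cross o2 u k2 x2 s0 s1, cross o3 u k3 x3 s1 s2]"
  if "trivalent v (k1, o1) (x2, o2) (x3, o3)" and "trivalent v' (x1, o1) (k2, o2) (k3, o3)"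
| V_first: "local_move {x1, x2, x3}
    [v]
    [v', cross o1 o2 k1 x1 k2 x2]"
  if "trivalent v (x1, o1) (x2, o2) (x3, o3)" and "trivalent v' (k2, o2) (k1, o1) (x3, o3)"
| V_second: "local_move {x1, x2, x3}
    [v]
    [v', cross o2 (\<not> o1) k2 x2 x1 k1]"
  if "trivalent v (x1, o1) (x2, o2) (x3, o3)" and "trivalent v' (k2, o2) (k1, o1) (x3, o3)"
| VI: "local_move {x1, x2, x3, s0, s2}
    [v, cross u o1 s0 s2 k1 x1]
    [v', cross u (\<not> o2) s0 s1 x2 k2, cross u (\<not> o3) s1 s2 x3 k3]"
  if "trivalent v (k1, o1) (x2, o2) (x3, o3)" and "trivalent v' (x1, o1) (k2, o2) (k3, o3)"

text \<open>
  \<open>R_move D D' out\<close>: \<open>D'\<close> is obtained from \<open>D\<close> by one R-move (in either direction), and \<open>out\<close> is the set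
  of edges that are not entirely contained in the small ball; these are common to \<open>D\<close> and \<open>D'\<close>.
\<close>

definition R_move :: "diagram \<Rightarrow> diagram \<Rightarrow> edge set \<Rightarrow> bool" where
  "R_move D D' out \<longleftrightarrow>
     is_diagram D \<and> is_diagram D' \<and> boundary D' = boundary D \<and>
     (\<exists>B L L' N.
        (local_move B L L' \<or> local_move B L' L) \<and>
        mset (nodes D) = mset (L @ N) \<and> mset (nodes D') = mset (L' @ N) \<and>
        out = B \<union> fst ` set (boundary D @ concat (map node_darts N)))"


section \<open>Colorings\<close>

text \<open>
  Arcs are represented by the sets of edges they consist of: an arc continues through
  joints, and through crossings along the over-strand.
\<close>

definition continues :: "diagram \<Rightarrow> (edge \<times> edge) set" where
  "continues D = {(x, y). Joint x y \<in> set (nodes D) \<or>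
                          (\<exists>s r l. Crossing s x y r l \<in> set (nodes D))}"

definition arc_of :: "diagram \<Rightarrow> edge \<Rightarrow> edge set" where
  "arc_of D e = (continues D \<union> (continues D)\<inverse>)\<^sup>* `` {e}"

definition arcs :: "diagram \<Rightarrow> edge set set" where
  "arcs D = arc_of D ` edges D"

text \<open>
  Coloring rules are given as a predicate that compares the colors of the arcs
  around a node; the first argument maps each edge to the color of its arc.
\<close>

type_synonym 'q coloring_rules = "(edge \<Rightarrow> 'q) \<Rightarrow> node \<Rightarrow> bool"

definition coloring :: "'q set \<Rightarrow> 'q coloring_rules \<Rightarrow> diagram \<Rightarrow> (edge set \<Rightarrow> 'q) \<Rightarrow> bool" where
  "coloring Q rules D C \<longleftrightarrow>
     C \<in> arcs D \<rightarrow>\<^sub>E Q \<and> (\<forall>v \<in> set (nodes D). rules (\<lambda>e. C (arc_of D e)) v)"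

definition topological :: "'q set \<Rightarrow> 'q coloring_rules \<Rightarrow> bool" where
  "topological Q rules \<longleftrightarrow>
     (\<forall>D D' out C. R_move D D' out \<and> coloring Q rules D C \<longrightarrow>
        (\<exists>!C'. coloring Q rules D' C' \<and> (\<forall>e \<in> out. C' (arc_of D' e) = C (arc_of D e))))"

fun qualgebra_rules :: "('q \<Rightarrow> 'q \<Rightarrow> 'q) \<Rightarrow> ('q \<Rightarrow> 'q \<Rightarrow> 'q) \<Rightarrow> 'q coloring_rules" where
  "qualgebra_rules tri dia c (Crossing s oi oo r l) \<longleftrightarrow> c l = tri (c r) (c oi)"
| "qualgebra_rules tri dia c (Zip x y z) \<longleftrightarrow> c z = dia (c x) (c y)"
| "qualgebra_rules tri dia c (Unzip x y z) \<longleftrightarrow> c z = dia (c x) (c y)"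
| "qualgebra_rules tri dia c (Joint x y) \<longleftrightarrow> True"


section \<open>Qualgebras\<close>

definition binary_operation :: "'q set \<Rightarrow> ('q \<Rightarrow> 'q \<Rightarrow> 'q) \<Rightarrow> bool" where
  "binary_operation Q f \<longleftrightarrow> (\<forall>a\<in>Q. \<forall>b\<in>Q. f a b \<in> Q)"

definition qualgebra :: "'q set \<Rightarrow> ('q \<Rightarrow> 'q \<Rightarrow> 'q) \<Rightarrow> ('q \<Rightarrow> 'q \<Rightarrow> 'q) \<Rightarrow> bool" where
  "qualgebra Q tri dia \<longleftrightarrow>
     binary_operation Q tri \<and> binary_operation Q dia \<and>
     (\<exists>inv_tri. binary_operation Q inv_tri \<and>
        (\<forall>a\<in>Q. \<forall>b\<in>Q. \<forall>c\<in>Q.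
           tri (tri a b) c = tri (tri a c) (tri b c) \<and>
           inv_tri (tri a b) b = a \<and> tri (inv_tri a b) b = a \<and>
           tri a a = a \<and>
           tri a (dia b c) = tri (tri a b) c \<and>
           tri (dia a b) c = dia (tri a c) (tri b c) \<and>
           dia a b = dia b (tri a b)))"

end

theory Submission
  imports Defs
begin

text \<open>
  An R-move changes a diagram only inside a ball, so the condition that colorings extend uniquely
  is a condition on the two tangles inside the ball: they must admit the same colorings of the
  edges that cross the boundary of the ball, and such a boundary coloring must determine the
  colors inside. Reading off the colors turns this condition into algebra, one axiom for each kind
  of move: I is idempotence, II is bijectivity of the right translations \<open>\<lambda>a. tri a b\<close>, III is
  self-distributivity, IV (a strand under a vertex) is \<open>tri a (dia b c) = tri (tri a b) c\<close>, VI (a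
  strand over a vertex) is distributivity of \<open>tri\<close> over \<open>dia\<close>, and V (a twist at a vertex) is
  \<open>dia a b = dia b (tri a b)\<close>.

  For the direction from a qualgebra to topological rules, every orientation of every move has to
  be treated. Reversing the over-strand of a crossing replaces \<open>tri\<close> by its right inverse, so both
  are packed into one operation \<open>act p\<close>, indexed by the direction of the over-strand, which
  satisfies the distributivity laws for all values of the index. Likewise zip and unzip vertices,
  seen from any of their three edges, are instances of one relation \<open>vertex_relation\<close>. Four facts
  about it cover all oriented vertex moves: it is preserved when a strand passes over the vertex
  (\<open>vertex_relation_act\<close>), it says that passing under one edge is the same as passing under the
  other two (\<open>vertex_relation_slide\<close>), and it is compatible with both kinds of twists
  (\<open>vertex_relation_twist_first\<close>, \<open>vertex_relation_twist_second\<close>). The local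
  statements are then glued to the unchanged outside of the ball
  (\<open>qualgebra_rules_topological\<close>).

  For the converse, one well-chosen orientation of each move suffices, applied to a disc
  that contains nothing but the tangle of the move. The edges of the tangle can be given arbitrary
  colors \<open>a\<close>, \<open>b\<close>, \<open>c\<close> at its inputs, and the extension of the coloring across the move gives the wanted
  axiom. What has to be checked here is that these pictures are planar diagrams, and
  \<open>is_diagramI\<close> reduces this to a list of their faces.
\<close>

section \<open>Edge colorings\<close>

text \<open>
  Colors of edges instead of arcs: the requirement that an arc has a single color becomes a local
  condition, namely that the color does not change along the over-strand of a crossing and at a
  joint. So colorings can be studied node by node.
\<close>

fun node_rule :: "('q \<Rightarrow> 'q \<Rightarrow> 'q) \<Rightarrow> ('q \<Rightarrow> 'q \<Rightarrow> 'q) \<Rightarrow> (edge \<Rightarrow> 'q) \<Rightarrow> node \<Rightarrow> bool" where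
  "node_rule tri dia c (Crossing s x y r l) \<longleftrightarrow> c y = c x \<and> c l = tri (c r) (c x)"
| "node_rule tri dia c (Zip x y z) \<longleftrightarrow> c z = dia (c x) (c y)"
| "node_rule tri dia c (Unzip x y z) \<longleftrightarrow> c z = dia (c x) (c y)"
| "node_rule tri dia c (Joint x y) \<longleftrightarrow> c y = c x"

abbreviation node_edges :: "node \<Rightarrow> edge set" where
  "node_edges v \<equiv> fst ` set (node_darts v)"

text \<open>
  The membership in \<open>Q\<close> is part of the condition at a node, so that a coloring of a tangle is just
  a coloring of each of its nodes.
\<close>

definition node_colored ::
  "'q set \<Rightarrow> ('q \<Rightarrow> 'q \<Rightarrow> 'q) \<Rightarrow> ('q \<Rightarrow> 'q \<Rightarrow> 'q) \<Rightarrow> (edge \<Rightarrow> 'q) \<Rightarrow> node \<Rightarrow> bool" where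
  "node_colored Q tri dia c v \<longleftrightarrow> node_rule tri dia c v \<and> c ` node_edges v \<subseteq> Q"

definition edge_coloring ::
  "'q set \<Rightarrow> ('q \<Rightarrow> 'q \<Rightarrow> 'q) \<Rightarrow> ('q \<Rightarrow> 'q \<Rightarrow> 'q) \<Rightarrow> diagram \<Rightarrow> (edge \<Rightarrow> 'q) \<Rightarrow> bool" where
  "edge_coloring Q tri dia D c \<longleftrightarrow>
     (\<forall>v \<in> set (nodes D). node_colored Q tri dia c v) \<and> c ` fst ` set (boundary D) \<subseteq> Q"

lemma edges_eq: "edges D = fst ` set (boundary D) \<union> (\<Union>v\<in>set (nodes D). node_edges v)"
  by (auto simp: edges_def darts_def vertex_cycles_def image_iff)

lemma node_colored_cong:
  assumes "\<And>e. e \<in> node_edges v \<Longrightarrow> c e = c' e"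
  shows "node_colored Q tri dia c v \<longleftrightarrow> node_colored Q tri dia c' v"
  using assms by (cases v) (auto simp: node_colored_def)

lemma edge_coloring_altdef:
  "edge_coloring Q tri dia D c \<longleftrightarrow>
     (\<forall>v \<in> set (nodes D). node_rule tri dia c v) \<and> c ` edges D \<subseteq> Q"
  unfolding edge_coloring_def node_colored_def edges_eq by blast

lemma edge_coloring_cong:
  assumes "\<And>e. e \<in> edges D \<Longrightarrow> c e = c' e"
  shows "edge_coloring Q tri dia D c \<longleftrightarrow> edge_coloring Q tri dia D c'"
proof -
  have "node_colored Q tri dia c v \<longleftrightarrow> node_colored Q tri dia c' v" if "v \<in> set (nodes D)" for v
    by (rule node_colored_cong) (use assms that in \<open>auto simp: edges_eq\<close>)
  moreover have "c ` fst ` set (boundary D) = c' ` fst ` set (boundary D)"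
    by (rule image_cong) (use assms in \<open>auto simp: edges_eq\<close>)
  ultimately show ?thesis unfolding edge_coloring_def by auto
qed

lemma arc_of_self: "e \<in> arc_of D e"
  by (auto simp: arc_of_def)

lemma arc_of_continues:
  assumes "(x, y) \<in> continues D" shows "arc_of D x = arc_of D y"
proof -
  let ?R = "(continues D \<union> (continues D)\<inverse>)\<^sup>*"
  have "(x, y) \<in> ?R" "(y, x) \<in> ?R" using assms by auto
  then show ?thesis unfolding arc_of_def by (auto intro: rtrancl_trans)
qed

text \<open>
  This is where the local continuity conditions in \<open>node_rule\<close> are propagated along a whole arc.
\<close>

lemma continues_constant:
  assumes "\<forall>v \<in> set (nodes D). node_rule tri dia c v" and "x \<in> arc_of D e"
  shows "c x = c e"
proof -
  have "(e, x) \<in> (continues D \<union> (continues D)\<inverse>)\<^sup>*" using assms(2) by (simp add: arc_of_def)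
  then show ?thesis
  proof (induction rule: rtrancl_induct)
    case (step y z)
    have "(y, z) \<in> continues D \<Longrightarrow> c z = c y" for y z
      using assms(1) by (auto simp: continues_def)
    with step show ?case by auto
  qed simp
qed

lemma edge_coloring_of_coloring:
  assumes "coloring Q (qualgebra_rules tri dia) D C"
  shows "edge_coloring Q tri dia D (\<lambda>e. C (arc_of D e))"
  unfolding edge_coloring_altdef
proof (intro conjI ballI)
  fix v assume v: "v \<in> set (nodes D)"
  have "qualgebra_rules tri dia (\<lambda>e. C (arc_of D e)) v"
    using assms v by (simp add: coloring_def)
  moreover have "arc_of D x = arc_of D y" if "v = Joint x y \<or> (\<exists>s r l. v = Crossing s x y r l)" for x y
    by (rule arc_of_continues) (use that v in \<open>auto simp: continues_def\<close>)
  ultimately show "node_rule tri dia (\<lambda>e. C (arc_of D e)) v" by (cases v) auto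
qed (use assms in \<open>auto simp: coloring_def arcs_def\<close>)

text \<open>
  An edge coloring is constant on arcs, so it descends to the arcs, and an arbitrary edge of an arc
  may be used to read off its color.
\<close>

lemma coloring_of_edge_coloring:
  assumes "edge_coloring Q tri dia D c"
  shows "\<exists>C. coloring Q (qualgebra_rules tri dia) D C \<and> (\<forall>e \<in> edges D. C (arc_of D e) = c e)"
proof -
  define C where "C = restrict (\<lambda>A. c (SOME e. e \<in> A)) (arcs D)"
  have C: "C (arc_of D e) = c e" if "e \<in> edges D" for e
  proof -
    have "(SOME x. x \<in> arc_of D e) \<in> arc_of D e" by (rule someI) (rule arc_of_self)
    then show ?thesis using that assms continues_constant
      by (simp add: C_def arcs_def edge_coloring_altdef) blast
  qed
  then have "edge_coloring Q tri dia D (\<lambda>e. C (arc_of D e))"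
    using assms by (simp cong: edge_coloring_cong)
  then have "\<forall>v \<in> set (nodes D). node_rule tri dia (\<lambda>e. C (arc_of D e)) v"
    and "(\<lambda>e. C (arc_of D e)) ` edges D \<subseteq> Q"
    by (simp_all add: edge_coloring_altdef)
  moreover have "node_rule tri dia b v \<Longrightarrow> qualgebra_rules tri dia b v" for b v
    by (cases v) auto
  ultimately have "coloring Q (qualgebra_rules tri dia) D C"
    by (auto simp: coloring_def arcs_def C_def)
  with C show ?thesis by blast
qed

lemma coloring_eqI:
  assumes "coloring Q rules D C" and "coloring Q rules D C'"
    and "\<And>e. e \<in> edges D \<Longrightarrow> C (arc_of D e) = C' (arc_of D e)"
  shows "C = C'"
  by (rule PiE_ext[of C "arcs D" "\<lambda>_. Q"]) (use assms in \<open>auto simp: coloring_def arcs_def\<close>)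

text \<open>
  The number of rotations only matters modulo 3. This turns the existential quantifier in
  \<open>trivalent\<close> into three equations that can be evaluated.
\<close>

lemma trivalent_rotations:
  "trivalent v d1 d2 d3 \<longleftrightarrow>
     node_darts v = [d1, d2, d3] \<or> node_darts v = [d3, d1, d2] \<or> node_darts v = [d2, d3, d1]"
proof
  assume "trivalent v d1 d2 d3"
  then obtain k where k: "rotate k (node_darts v) = [d1, d2, d3]"
    by (auto simp: trivalent_def)
  then have "length (node_darts v) = 3"
    by (metis length_rotate length_Cons list.size(3) numeral_3_eq_3)
  then obtain x y z where xyz: "node_darts v = [x, y, z]"
    by (auto simp: numeral_3_eq_3 length_Suc_conv)
  have "rotate (k mod 3) [x, y, z] = [d1, d2, d3]"
    using k xyz rotate_conv_mod[of k "node_darts v"] by simp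
  moreover have "k mod 3 = 0 \<or> k mod 3 = Suc 0 \<or> k mod 3 = Suc (Suc 0)" by linarith
  ultimately show "node_darts v = [d1, d2, d3] \<or> node_darts v = [d3, d1, d2] \<or>
      node_darts v = [d2, d3, d1]"
    unfolding xyz by (elim disjE) simp_all
next
  assume "node_darts v = [d1, d2, d3] \<or> node_darts v = [d3, d1, d2] \<or> node_darts v = [d2, d3, d1]"
  then have "rotate 0 (node_darts v) = [d1, d2, d3] \<or> rotate 1 (node_darts v) = [d1, d2, d3] \<or>
      rotate (Suc 1) (node_darts v) = [d1, d2, d3]"
    by auto
  then show "trivalent v d1 d2 d3" unfolding trivalent_def by blast
qed

lemma trivalent_node_darts:
  assumes "trivalent v d1 d2 d3"
  shows "set (node_darts v) = {d1, d2, d3}" "distinct (node_darts v) \<longleftrightarrow> distinct [d1, d2, d3]"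
  using assms by (auto simp: trivalent_rotations)

lemma cross_node_darts:
  "set (node_darts (cross p q s n e w)) = {(n, p), (w, q), (s, \<not> p), (e, \<not> q)}"
  "distinct (node_darts (cross p q s n e w)) \<longleftrightarrow> distinct [(n, p), (w, q), (s, \<not> p), (e, \<not> q)]"
  by (auto simp: cross_def)

lemma strand_node_darts:
  "set (node_darts (strand p x y)) = {(x, \<not> p), (y, p)}"
  by (auto simp: strand_def)

lemmas node_darts_simps = cross_node_darts strand_node_darts trivalent_node_darts

section \<open>Tangles and the locality of moves\<close>

abbreviation tangle_darts :: "node list \<Rightarrow> dart list" where
  "tangle_darts L \<equiv> concat (map node_darts L)"

definition tangle_move :: "edge set \<Rightarrow> node list \<Rightarrow> node list \<Rightarrow> bool" where
  "tangle_move B L L' \<longleftrightarrow> local_move B L L' \<or> local_move B L' L"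

lemma local_move_boundary:
  assumes "local_move B L L'"
  shows "B \<subseteq> fst ` set (tangle_darts L)" "B \<subseteq> fst ` set (tangle_darts L')"
  using assms by (induction rule: local_move.induct) (auto simp: node_darts_simps)

text \<open>
  An edge that does not cross the boundary of the ball has both of its ends in the tangle. As ends
  are not shared, it cannot reappear outside the ball; hence colors inside and outside can be
  chosen independently once they agree on \<open>B\<close>.
\<close>

lemma local_move_internal:
  assumes "local_move B L L'"
  shows "e \<in> fst ` set (tangle_darts L) - B \<Longrightarrow> (e, o1) \<in> set (tangle_darts L)"
    and "e \<in> fst ` set (tangle_darts L') - B \<Longrightarrow> (e, o1) \<in> set (tangle_darts L')"
  using assms by (induction rule: local_move.induct) (auto simp: node_darts_simps)

lemma tangle_move_boundary:
  assumes "tangle_move B L L'"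
  shows "B \<subseteq> fst ` set (tangle_darts L)" "B \<subseteq> fst ` set (tangle_darts L')"
  using assms local_move_boundary unfolding tangle_move_def by blast+

lemma tangle_move_internal:
  assumes "tangle_move B L L'" and "e \<in> fst ` set (tangle_darts L')" and "e \<notin> B"
  shows "(e, b) \<in> set (tangle_darts L')"
  using assms local_move_internal unfolding tangle_move_def by blast

lemma R_moveE:
  assumes "R_move D D' out"
  obtains B L L' N where "tangle_move B L L'"
    "set (nodes D) = set L \<union> set N" "set (nodes D') = set L' \<union> set N"
    "boundary D' = boundary D"
    "out = B \<union> fst ` set (boundary D) \<union> (\<Union>v\<in>set N. node_edges v)"
    "distinct (boundary D' @ tangle_darts L' @ tangle_darts N)"
proof -
  from assms obtain B L L' N where *: "tangle_move B L L'"
      "mset (nodes D) = mset (L @ N)" "mset (nodes D') = mset (L' @ N)"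
      "boundary D' = boundary D" "is_diagram D'"
      "out = B \<union> fst ` set (boundary D @ tangle_darts N)"
    unfolding R_move_def tangle_move_def by blast
  have "mset (map node_darts (nodes D')) = mset (map node_darts (L' @ N))"
    unfolding mset_map *(3) ..
  then have "mset (tangle_darts (nodes D')) = mset (tangle_darts (L' @ N))"
    unfolding mset_concat by (metis mset_map sum_mset_sum_list)
  then have "mset (boundary D' @ tangle_darts L' @ tangle_darts N) = mset (concat (vertex_cycles D'))"
    by (simp add: vertex_cycles_def)
  moreover have "distinct (concat (vertex_cycles D'))" using *(5) by (simp add: is_diagram_def)
  ultimately have "distinct (boundary D' @ tangle_darts L' @ tangle_darts N)"
    using mset_eq_imp_distinct_iff by blast
  moreover have "set (nodes D) = set L \<union> set N" "set (nodes D') = set L' \<union> set N"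
    using *(2,3) by (metis mset_eq_setD set_append)+
  moreover have "out = B \<union> fst ` set (boundary D) \<union> (\<Union>v\<in>set N. node_edges v)"
    unfolding *(6) by auto
  ultimately show ?thesis using that *(1,4) by blast
qed

lemma R_move_out_subset_edges:
  assumes "R_move D D' out"
  shows "out \<subseteq> edges D" "out \<subseteq> edges D'"
proof -
  obtain B L L' N where B: "tangle_move B L L'"
    and "set (nodes D) = set L \<union> set N" "set (nodes D') = set L' \<union> set N"
    "boundary D' = boundary D"
    "out = B \<union> fst ` set (boundary D) \<union> (\<Union>v\<in>set N. node_edges v)"
    by (rule R_moveE[OF assms])
  moreover have "B \<subseteq> (\<Union>v\<in>set L. node_edges v)" "B \<subseteq> (\<Union>v\<in>set L'. node_edges v)"
    using tangle_move_boundary[OF B] by (simp_all add: image_UN)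
  ultimately show "out \<subseteq> edges D" "out \<subseteq> edges D'"
    by (auto simp: edges_eq)
qed

text \<open>
  The color function of an edge coloring is arbitrary outside the edges of the diagram, so
  uniqueness has to be phrased as agreement on the edges.
\<close>

lemma topological_iff_edge_colorings:
  "topological Q (qualgebra_rules tri dia) \<longleftrightarrow>
     (\<forall>D D' out c. R_move D D' out \<and> edge_coloring Q tri dia D c \<longrightarrow>
        (\<exists>c'. edge_coloring Q tri dia D' c' \<and> (\<forall>e \<in> out. c' e = c e) \<and>
           (\<forall>c''. edge_coloring Q tri dia D' c'' \<and> (\<forall>e \<in> out. c'' e = c e) \<longrightarrow>
             (\<forall>e \<in> edges D'. c'' e = c' e))))" (is "_ \<longleftrightarrow> ?edges")
proof
  assume top: "topological Q (qualgebra_rules tri dia)"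
  show ?edges
  proof (intro allI impI, elim conjE)
    fix D D' out c assume move: "R_move D D' out" and c: "edge_coloring Q tri dia D c"
    note out = R_move_out_subset_edges[OF move]
    obtain C where C: "coloring Q (qualgebra_rules tri dia) D C" "\<forall>e \<in> edges D. C (arc_of D e) = c e"
      using coloring_of_edge_coloring[OF c] by blast
    let ?extends = "\<lambda>C'. coloring Q (qualgebra_rules tri dia) D' C' \<and>
      (\<forall>e \<in> out. C' (arc_of D' e) = C (arc_of D e))"
    have "\<exists>!C'. ?extends C'" using top move C(1) unfolding topological_def by blast
    then obtain C' where C': "coloring Q (qualgebra_rules tri dia) D' C'"
        "\<forall>e \<in> out. C' (arc_of D' e) = C (arc_of D e)"
      and unique: "\<And>C''. ?extends C'' \<Longrightarrow> C'' = C'"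
      by blast
    have "\<forall>e \<in> edges D'. c'' e = C' (arc_of D' e)"
      if c'': "edge_coloring Q tri dia D' c''" "\<forall>e \<in> out. c'' e = c e" for c''
    proof -
      obtain C'' where C'': "coloring Q (qualgebra_rules tri dia) D' C''"
          "\<forall>e \<in> edges D'. C'' (arc_of D' e) = c'' e"
        using coloring_of_edge_coloring[OF c''(1)] by blast
      have "\<forall>e \<in> out. C'' (arc_of D' e) = C (arc_of D e)"
        using C''(2) C(2) c''(2) out by (metis subsetD)
      then have "C'' = C'" using C''(1) unique by blast
      then show ?thesis using C''(2) by simp
    qed
    moreover have "\<forall>e \<in> out. C' (arc_of D' e) = c e" using C'(2) C(2) out by (metis subsetD)
    ultimately show "\<exists>c'. edge_coloring Q tri dia D' c' \<and> (\<forall>e \<in> out. c' e = c e) \<and>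
           (\<forall>c''. edge_coloring Q tri dia D' c'' \<and> (\<forall>e \<in> out. c'' e = c e) \<longrightarrow>
             (\<forall>e \<in> edges D'. c'' e = c' e))"
      using edge_coloring_of_coloring[OF C'(1)] by blast
  qed
next
  assume edges: ?edges
  show "topological Q (qualgebra_rules tri dia)"
    unfolding topological_def
  proof (intro allI impI, elim conjE)
    fix D D' out C assume move: "R_move D D' out" and C: "coloring Q (qualgebra_rules tri dia) D C"
    note out = R_move_out_subset_edges[OF move]
    obtain c' where c': "edge_coloring Q tri dia D' c'" "\<forall>e \<in> out. c' e = C (arc_of D e)"
      and unique: "\<And>c''. edge_coloring Q tri dia D' c'' \<Longrightarrow> \<forall>e \<in> out. c'' e = C (arc_of D e)
        \<Longrightarrow> \<forall>e \<in> edges D'. c'' e = c' e"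
      using edges[rule_format, OF conjI[OF move edge_coloring_of_coloring[OF C]]] by blast
    obtain C' where C': "coloring Q (qualgebra_rules tri dia) D' C'"
        "\<forall>e \<in> edges D'. C' (arc_of D' e) = c' e"
      using coloring_of_edge_coloring[OF c'(1)] by blast
    show "\<exists>!C'. coloring Q (qualgebra_rules tri dia) D' C' \<and>
        (\<forall>e \<in> out. C' (arc_of D' e) = C (arc_of D e))"
    proof (rule ex1I[of _ C'])
      show "coloring Q (qualgebra_rules tri dia) D' C' \<and>
          (\<forall>e \<in> out. C' (arc_of D' e) = C (arc_of D e))"
        using C' c'(2) out by (metis subsetD)
    next
      fix C'' assume C'': "coloring Q (qualgebra_rules tri dia) D' C'' \<and>
          (\<forall>e \<in> out. C'' (arc_of D' e) = C (arc_of D e))"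
      then have "\<forall>e \<in> edges D'. C'' (arc_of D' e) = c' e"
        using unique[OF edge_coloring_of_coloring] by blast
      then have "C'' (arc_of D' e) = C' (arc_of D' e)" if "e \<in> edges D'" for e
        using C'(2) that by simp
      then show "C'' = C'" using C'' C'(1) coloring_eqI by blast
    qed
  qed
qed

section \<open>Qualgebras color all tangles consistently\<close>

text \<open>
  The right inverse of \<open>tri\<close> is a parameter here, since crossings traversed from left to right use it
  on a par with \<open>tri\<close>.
\<close>

locale qualgebra_ops =
  fixes Q :: "'q set" and tri dia inv :: "'q \<Rightarrow> 'q \<Rightarrow> 'q"
  assumes tri_closed: "\<lbrakk>a \<in> Q; b \<in> Q\<rbrakk> \<Longrightarrow> tri a b \<in> Q"
    and dia_closed: "\<lbrakk>a \<in> Q; b \<in> Q\<rbrakk> \<Longrightarrow> dia a b \<in> Q"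
    and inv_closed: "\<lbrakk>a \<in> Q; b \<in> Q\<rbrakk> \<Longrightarrow> inv a b \<in> Q"
    and tri_distrib: "\<lbrakk>a \<in> Q; b \<in> Q; c \<in> Q\<rbrakk> \<Longrightarrow> tri (tri a b) c = tri (tri a c) (tri b c)"
    and inv_tri: "\<lbrakk>a \<in> Q; b \<in> Q\<rbrakk> \<Longrightarrow> inv (tri a b) b = a"
    and tri_inv: "\<lbrakk>a \<in> Q; b \<in> Q\<rbrakk> \<Longrightarrow> tri (inv a b) b = a"
    and tri_idem: "a \<in> Q \<Longrightarrow> tri a a = a"
    and tri_dia: "\<lbrakk>a \<in> Q; b \<in> Q; c \<in> Q\<rbrakk> \<Longrightarrow> tri a (dia b c) = tri (tri a b) c"
    and dia_tri: "\<lbrakk>a \<in> Q; b \<in> Q; c \<in> Q\<rbrakk> \<Longrightarrow> tri (dia a b) c = dia (tri a c) (tri b c)"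
    and dia_swap: "\<lbrakk>a \<in> Q; b \<in> Q\<rbrakk> \<Longrightarrow> dia a b = dia b (tri a b)"
begin

text \<open>
  The color of an under-strand on its way from the right to the left of an over-strand is changed
  by \<open>tri\<close>. If one crosses a strand that is directed from bottom to top in the picture (\<open>p\<close> holds)
  from the right side of the picture to the left, the color changes by \<open>act p\<close>; if it is directed
  from top to bottom, left and right of the strand are exchanged and the change is undone.
\<close>

definition act :: "bool \<Rightarrow> 'q \<Rightarrow> 'q \<Rightarrow> 'q" where
  "act p a b = (if p then tri a b else inv a b)"

lemma act_closed: "\<lbrakk>a \<in> Q; b \<in> Q\<rbrakk> \<Longrightarrow> act p a b \<in> Q"
  by (simp add: act_def tri_closed inv_closed)

lemma act_cancel: "\<lbrakk>a \<in> Q; b \<in> Q\<rbrakk> \<Longrightarrow> act (\<not> p) (act p a b) b = a"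
  and act_cancel': "\<lbrakk>a \<in> Q; b \<in> Q\<rbrakk> \<Longrightarrow> act p (act (\<not> p) a b) b = a"
  by (simp_all add: act_def inv_tri tri_inv)

lemma act_inject: "\<lbrakk>a \<in> Q; a' \<in> Q; b \<in> Q\<rbrakk> \<Longrightarrow> act p a b = act p a' b \<longleftrightarrow> a = a'"
  by (metis act_cancel)

lemma inv_eqI: "\<lbrakk>a \<in> Q; b \<in> Q; tri a b = c\<rbrakk> \<Longrightarrow> inv c b = a"
  using inv_tri by auto

lemma act_distrib_tri:
  "\<lbrakk>a \<in> Q; b \<in> Q; c \<in> Q\<rbrakk> \<Longrightarrow> act t (tri a b) c = tri (act t a c) (act t b c)"
  using tri_distrib[of a b c] tri_distrib[of "inv a c" "inv b c" c]
  by (auto simp: act_def tri_closed inv_closed tri_inv intro!: inv_eqI)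

text \<open>
  Right translations are automorphisms of \<open>tri\<close>, hence so are their inverses, and automorphisms of
  \<open>tri\<close> also respect its inverse operation. This covers all orientations of the move III at once.
\<close>

lemma act_distrib:
  assumes "a \<in> Q" "b \<in> Q" "c \<in> Q"
  shows "act t (act m a b) c = act m (act t a c) (act t b c)"
proof (cases m)
  case True
  then show ?thesis using assms act_distrib_tri by (simp add: act_def)
next
  case False
  have "tri (act t (inv a b) c) (act t b c) = act t a c"
    using assms by (simp add: act_distrib_tri[symmetric] inv_closed tri_inv)
  then have "act t (inv a b) c = inv (act t a c) (act t b c)"
    using assms by (auto simp: act_closed inv_closed intro!: inv_eqI[symmetric])
  then show ?thesis using False by (simp add: act_def)
qed

lemma act_dia:
  "\<lbrakk>a \<in> Q; b \<in> Q; c \<in> Q\<rbrakk> \<Longrightarrow> act t (dia a b) c = dia (act t a c) (act t b c)"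
  by (cases t) (auto simp: act_def inv_closed dia_closed dia_tri tri_inv intro!: inv_eqI)

lemma inv_dia: "\<lbrakk>a \<in> Q; b \<in> Q; c \<in> Q\<rbrakk> \<Longrightarrow> inv a (dia b c) = inv (inv a c) b"
  by (rule inv_eqI) (simp_all add: inv_closed dia_closed tri_dia tri_inv)

text \<open>
  The twist identity in the position where the product itself is the over-strand. In the direction
  from right to left the equation is implicit in \<open>a\<close>: acting by \<open>a = dia d (tri b a)\<close> on \<open>b\<close> gives
  \<open>k = tri (tri b d) k\<close> for \<open>k = tri b a\<close>, and comparison with \<open>k = tri k k\<close> yields \<open>k = tri b d\<close>.
\<close>

lemma dia_slide:
  assumes "a \<in> Q" "b \<in> Q" "d \<in> Q"
  shows "a = dia b d \<longleftrightarrow> a = dia d (tri b a)"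
proof
  assume "a = dia b d"
  then show "a = dia d (tri b a)"
    using assms by (simp add: tri_dia tri_idem dia_swap[symmetric])
next
  assume a: "a = dia d (tri b a)"
  let ?k = "tri b a"
  have k: "?k \<in> Q" "tri b d \<in> Q" using assms by (simp_all add: tri_closed)
  have "tri ?k ?k = tri (tri b d) ?k"
    using assms k tri_dia[of b d ?k] by (simp add: tri_idem flip: a)
  then have "?k = tri b d"
    using k inv_tri by metis
  then show "a = dia b d" using a assms dia_swap by simp
qed

text \<open>
  The coloring rule at a vertex with edges colored \<open>a1\<close>, \<open>a2\<close>, \<open>a3\<close> in counterclockwise order, where
  \<open>oi\<close> tells whether the i-th edge leaves the vertex. A well-oriented vertex has at least one
  incoming and at least one outgoing edge, which leaves the six cases below: in each of them the
  edge whose direction differs from the other two is the product.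
\<close>

definition vertex_relation :: "bool \<Rightarrow> 'q \<Rightarrow> bool \<Rightarrow> 'q \<Rightarrow> bool \<Rightarrow> 'q \<Rightarrow> bool" where
  "vertex_relation o1 a1 o2 a2 o3 a3 \<longleftrightarrow>
    (case (o1, o2, o3) of
       (False, True, False) \<Rightarrow> a2 = dia a1 a3
     | (True, False, False) \<Rightarrow> a1 = dia a3 a2
     | (False, False, True) \<Rightarrow> a3 = dia a2 a1
     | (False, True, True) \<Rightarrow> a1 = dia a2 a3
     | (True, True, False) \<Rightarrow> a3 = dia a1 a2
     | (True, False, True) \<Rightarrow> a2 = dia a3 a1
     | _ \<Rightarrow> False)"

lemmas closed = tri_closed dia_closed inv_closed act_closed

text \<open>
  The move VI: a strand passing over the vertex changes all three colors by the same right
  translation or its inverse, which is an automorphism of \<open>dia\<close>.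
\<close>

lemma vertex_relation_act:
  assumes "a1 \<in> Q" "a2 \<in> Q" "a3 \<in> Q" "s \<in> Q"
  shows "vertex_relation o1 (act u a1 s) o2 (act u a2 s) o3 (act u a3 s) \<longleftrightarrow>
    vertex_relation o1 a1 o2 a2 o3 a3"
  using assms
  by (cases o1; cases o2; cases o3)
    (simp_all add: vertex_relation_def act_dia[symmetric] act_inject closed)

text \<open>
  The move IV: a strand that passes under the first edge arrives at the same color as
  one that goes around the vertex on the other side, under the second and the third edge.
\<close>

lemma vertex_relation_slide:
  assumes "vertex_relation o1 a1 o2 a2 o3 a3" "a1 \<in> Q" "a2 \<in> Q" "a3 \<in> Q" "s \<in> Q"
  shows "act (\<not> o1) s a1 = act o3 (act o2 s a2) a3"
  using assms
  by (cases o1; cases o2; cases o3)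
    (simp_all add: vertex_relation_def act_def tri_dia inv_dia inv_tri tri_inv closed)

text \<open>
  The move V with the first edge on top. If the third edge is the product, this is \<open>dia_swap\<close>. If the
  under-strand is the product of \<open>a1\<close> and \<open>a3\<close> in one order, its passage under \<open>a1\<close> reverses the
  order, because \<open>a1\<close> acts trivially on itself. If the over-strand is the product, this is
  \<open>dia_slide\<close>.
\<close>

lemma vertex_relation_twist_first:
  assumes "a1 \<in> Q" "a2 \<in> Q" "a3 \<in> Q"
  shows "vertex_relation o2 (act (\<not> o1) a2 a1) o1 a1 o3 a3 \<longleftrightarrow>
    vertex_relation o1 a1 o2 a2 o3 a3"
proof -
  have 1: "dia (inv a2 a1) a1 = dia a1 a2" "dia a1 (tri a2 a1) = dia a2 a1"
    using assms dia_swap[of "inv a2 a1" a1] dia_swap[of a2 a1] by (simp_all add: inv_closed tri_inv)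
  have "tri (dia a1 a3) a1 = dia a3 a1"
    using assms dia_swap[of a3 a1] by (simp add: dia_tri tri_idem)
  then have 2: "inv a2 a1 = dia a1 a3 \<longleftrightarrow> a2 = dia a3 a1" "tri a2 a1 = dia a3 a1 \<longleftrightarrow> a2 = dia a1 a3"
    using assms by (metis dia_closed inv_tri tri_inv)+
  have 3: "a1 = dia (inv a2 a1) a3 \<longleftrightarrow> a1 = dia a3 a2" "a1 = dia a3 (tri a2 a1) \<longleftrightarrow> a1 = dia a2 a3"
    using assms dia_slide[of a1 "inv a2 a1" a3] dia_slide[of a1 a2 a3]
    by (auto simp: closed tri_inv)
  show ?thesis
    by (auto simp: vertex_relation_def act_def 1 2 3 split: bool.split)
qed

text \<open>
  At the twisted vertex the over-strand is the first edge, so a twist of the previous kind undoes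
  this one.
\<close>

lemma vertex_relation_twist_second:
  assumes "a1 \<in> Q" "a2 \<in> Q" "a3 \<in> Q"
  shows "vertex_relation o2 a2 o1 (act o2 a1 a2) o3 a3 \<longleftrightarrow>
    vertex_relation o1 a1 o2 a2 o3 a3"
  using vertex_relation_twist_first[of a2 "act o2 a1 a2" a3 o1 o2 o3] assms
  by (simp add: act_cancel act_closed)

abbreviation colored :: "(edge \<Rightarrow> 'q) \<Rightarrow> node \<Rightarrow> bool" where
  "colored \<equiv> node_colored Q tri dia"

lemma colored_strand: "colored c (strand p x y) \<longleftrightarrow> c x \<in> Q \<and> c y = c x"
  by (auto simp: node_colored_def strand_def)

lemma colored_Joint: "colored c (Joint x y) \<longleftrightarrow> c x \<in> Q \<and> c y = c x"
  by (auto simp: node_colored_def)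

lemma colored_Crossing:
  "colored c (Crossing q x y r l) \<longleftrightarrow> c x \<in> Q \<and> c r \<in> Q \<and> c y = c x \<and> c l = tri (c r) (c x)"
  by (auto simp: node_colored_def closed)

text \<open>
  Here the operation \<open>act\<close> pays off: the rule no longer depends on the direction of the
  under-strand, and on that of the over-strand only through the index.
\<close>

lemma colored_cross:
  "colored c (cross p q s n e w) \<longleftrightarrow>
     c s \<in> Q \<and> c e \<in> Q \<and> c n = c s \<and> c w = act p (c e) (c s)"
  by (auto simp: cross_def colored_Crossing act_def closed tri_inv inv_tri)

lemma colored_trivalent:
  assumes "trivalent v (e1, o1) (e2, o2) (e3, o3)"
  shows "colored c v \<longleftrightarrow>
    c e1 \<in> Q \<and> c e2 \<in> Q \<and> c e3 \<in> Q \<and> vertex_relation o1 (c e1) o2 (c e2) o3 (c e3)"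
  using assms
  by (cases v) (auto simp: trivalent_rotations node_colored_def vertex_relation_def)

lemmas colored_simps = colored_strand colored_Joint colored_Crossing colored_cross colored_trivalent

text \<open>
  The colors inside a tangle are determined by those on its boundary. For each tangle the inner
  colors are expressed by outer ones; where the strand is on top its color is simply continued, and
  an under-strand is followed from the end at which its color is known.
\<close>

lemma local_move_unique_left:
  assumes "local_move B L L'" "\<forall>v \<in> set L. colored c v" "\<forall>v \<in> set L. colored c' v"
    and "\<forall>e \<in> B. c e = c' e"
  shows "\<forall>e \<in> fst ` set (tangle_darts L). c e = c' e"
  using assms
proof (induction rule: local_move.induct)
  case (I_over_right x y m)
  show ?case using I_over_right.prems(1-3) by (auto simp: colored_simps node_darts_simps)
next
  case (I_over_left x y m)
  show ?case using I_over_left.prems(1-3) by (auto simp: colored_simps node_darts_simps)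
next
  case (I_under_right x y m)
  show ?case using I_under_right.prems(1-3) by (auto simp: colored_simps node_darts_simps)
next
  case (I_under_left x y m)
  show ?case using I_under_left.prems(1-3) by (auto simp: colored_simps node_darts_simps)
next
  case (II b1 t1 b2 t2 p q m k)
  show ?case using II.prems(1-3) by (auto simp: colored_simps node_darts_simps)
next
  case (III_up t0 t2 m0 m2 b0 b2 t m t1 m1 b b1 m1' b1' t1')
  have "d t1 = d t0 \<and> d m1 = d m2 \<and> d b1 = act m (d b2) (d m2)"
    if "\<forall>v \<in> set [cross t (\<not> m) t0 t1 m1 m0,
        cross t (\<not> b) t1 t2 b1 b0, cross m (\<not> b) m1 m2 b2 b1]. colored d v" for d
    using that by (auto simp: colored_simps act_cancel act_cancel')
  from this[OF III_up.prems(1)] this[OF III_up.prems(2)]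
  show ?case using III_up.prems(3) by (simp add: node_darts_simps)
next
  case (III_down t0 t2 m0 m2 b0 b2 t b t1 b1 m m1 m1' b1' t1')
  have "d t1 = d t0 \<and> d m1 = d m2 \<and> d b1 = act (\<not> m) (d b2) (d m2)"
    if "\<forall>v \<in> set [cross t (\<not> b) t0 t1 b1 b0,
        cross t (\<not> m) t1 t2 m1 m0, cross (\<not> m) (\<not> b) m2 m1 b2 b1]. colored d v" for d
    using that by (auto simp: colored_simps act_cancel act_cancel')
  from this[OF III_down.prems(1)] this[OF III_down.prems(2)]
  show ?case using III_down.prems(3) by (simp add: node_darts_simps)
next
  case (IV v k1 o1 x2 o2 x3 o3 v' x1 k2 k3 s0 s2 u s1)
  have "d k1 = d x1"
    if "\<forall>v \<in> set [v, cross (\<not> o1) u x1 k1 s0 s2]. colored d v" for d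
    using that IV.hyps(1) by (auto simp: colored_simps act_cancel act_cancel')
  from this[OF IV.prems(1)] this[OF IV.prems(2)]
  show ?case using IV.prems(3) IV.hyps(1) by (simp add: node_darts_simps)
next
  case (V_first v x1 o1 x2 o2 x3 o3 v' k2 k1)
  show ?case using V_first.prems(1-3) V_first.hyps(1) by (auto simp: colored_simps node_darts_simps)
next
  case (V_second v x1 o1 x2 o2 x3 o3 v' k2 k1)
  show ?case using V_second.prems(1-3) V_second.hyps(1) by (auto simp: colored_simps node_darts_simps)
next
  case (VI v k1 o1 x2 o2 x3 o3 v' x1 k2 k3 s0 s2 u s1)
  have "d k1 = act (\<not> u) (d x1) (d s0)"
    if "\<forall>v \<in> set [v, cross u o1 s0 s2 k1 x1]. colored d v" for d
    using that VI.hyps(1) by (auto simp: colored_simps act_cancel act_cancel')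
  from this[OF VI.prems(1)] this[OF VI.prems(2)]
  show ?case using VI.prems(3) VI.hyps(1) by (simp add: node_darts_simps)
qed

lemma local_move_unique_right:
  assumes "local_move B L L'" "\<forall>v \<in> set L'. colored c v" "\<forall>v \<in> set L'. colored c' v"
    and "\<forall>e \<in> B. c e = c' e"
  shows "\<forall>e \<in> fst ` set (tangle_darts L'). c e = c' e"
  using assms
proof (induction rule: local_move.induct)
  case (I_over_right x y m)
  have "d m = d x"
    if "\<forall>v \<in> set [Crossing True x m m y]. colored d v" for d
    using that by (auto simp: colored_simps act_cancel act_cancel')
  from this[OF I_over_right.prems(1)] this[OF I_over_right.prems(2)]
  show ?case using I_over_right.prems(3) by (simp add: node_darts_simps)
next
  case (I_over_left x y m)
  have "d m = d x"
    if "\<forall>v \<in> set [Crossing False x m y m]. colored d v" for d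
    using that by (auto simp: colored_simps act_cancel act_cancel')
  from this[OF I_over_left.prems(1)] this[OF I_over_left.prems(2)]
  show ?case using I_over_left.prems(3) by (simp add: node_darts_simps)
next
  case (I_under_right x y m)
  have "d m = d y"
    if "\<forall>v \<in> set [Crossing True m y x m]. colored d v" for d
    using that by (auto simp: colored_simps act_cancel act_cancel')
  from this[OF I_under_right.prems(1)] this[OF I_under_right.prems(2)]
  show ?case using I_under_right.prems(3) by (simp add: node_darts_simps)
next
  case (I_under_left x y m)
  have "d m = d y"
    if "\<forall>v \<in> set [Crossing False m y m x]. colored d v" for d
    using that by (auto simp: colored_simps act_cancel act_cancel')
  from this[OF I_under_left.prems(1)] this[OF I_under_left.prems(2)]
  show ?case using I_under_left.prems(3) by (simp add: node_darts_simps)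
next
  case (II b1 t1 b2 t2 p q m k)
  have "d m = d b1 \<and> d k = act p (d b2) (d b1)"
    if "\<forall>v \<in> set [cross p q b1 m b2 k, cross p (\<not> q) m t1 t2 k]. colored d v" for d
    using that by (auto simp: colored_simps act_cancel act_cancel')
  from this[OF II.prems(1)] this[OF II.prems(2)]
  show ?case using II.prems(3) by (simp add: node_darts_simps)
next
  case (III_up t0 t2 m0 m2 b0 b2 t m t1 m1 b b1 m1' b1' t1')
  have "d t1' = d t0 \<and> d m1' = d m0 \<and> d b1' = act t (d b2) (d t0)"
    if "\<forall>v \<in> set [cross m (\<not> b) m0 m1' b1' b0,
        cross t (\<not> b) t0 t1' b2 b1', cross t (\<not> m) t1' t2 m2 m1']. colored d v" for d
    using that by (auto simp: colored_simps act_cancel act_cancel')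
  from this[OF III_up.prems(1)] this[OF III_up.prems(2)]
  show ?case using III_up.prems(3) by (simp add: node_darts_simps)
next
  case (III_down t0 t2 m0 m2 b0 b2 t b t1 b1 m m1 m1' b1' t1')
  have "d t1' = d t0 \<and> d m1' = d m0 \<and> d b1' = act t (d b2) (d t0)"
    if "\<forall>v \<in> set [cross (\<not> m) (\<not> b) m1' m0 b1' b0,
        cross t (\<not> m) t0 t1' m2 m1', cross t (\<not> b) t1' t2 b2 b1']. colored d v" for d
    using that by (auto simp: colored_simps act_cancel act_cancel')
  from this[OF III_down.prems(1)] this[OF III_down.prems(2)]
  show ?case using III_down.prems(3) by (simp add: node_darts_simps)
next
  case (IV v k1 o1 x2 o2 x3 o3 v' x1 k2 k3 s0 s2 u s1)
  have "d k2 = d x2 \<and> d k3 = d x3 \<and> d s1 = act o2 (d s0) (d x2)"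
    if "\<forall>v \<in> set [v', cross o2 u k2 x2 s0 s1, cross o3 u k3 x3 s1 s2]. colored d v" for d
    using that IV.hyps(2) by (auto simp: colored_simps act_cancel act_cancel')
  from this[OF IV.prems(1)] this[OF IV.prems(2)]
  show ?case using IV.prems(3) IV.hyps(2) by (simp add: node_darts_simps)
next
  case (V_first v x1 o1 x2 o2 x3 o3 v' k2 k1)
  have "d k1 = d x1 \<and> d k2 = act (\<not> o1) (d x2) (d x1)"
    if "\<forall>v \<in> set [v', cross o1 o2 k1 x1 k2 x2]. colored d v" for d
    using that V_first.hyps(2) by (auto simp: colored_simps act_cancel act_cancel')
  from this[OF V_first.prems(1)] this[OF V_first.prems(2)]
  show ?case using V_first.prems(3) V_first.hyps(2) by (simp add: node_darts_simps)
next
  case (V_second v x1 o1 x2 o2 x3 o3 v' k2 k1)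
  have "d k2 = d x2 \<and> d k1 = act o2 (d x1) (d x2)"
    if "\<forall>v \<in> set [v', cross o2 (\<not> o1) k2 x2 x1 k1]. colored d v" for d
    using that V_second.hyps(2) by (auto simp: colored_simps act_cancel act_cancel')
  from this[OF V_second.prems(1)] this[OF V_second.prems(2)]
  show ?case using V_second.prems(3) V_second.hyps(2) by (simp add: node_darts_simps)
next
  case (VI v k1 o1 x2 o2 x3 o3 v' x1 k2 k3 s0 s2 u s1)
  have "d k2 = act u (d x2) (d s0) \<and> d k3 = act u (d x3) (d s0) \<and> d s1 = d s0"
    if "\<forall>v \<in> set [v', cross u (\<not> o2) s0 s1 x2 k2, cross u (\<not> o3) s1 s2 x3 k3]. colored d v" for d
    using that VI.hyps(2) by (auto simp: colored_simps act_cancel act_cancel')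
  from this[OF VI.prems(1)] this[OF VI.prems(2)]
  show ?case using VI.prems(3) VI.hyps(2) by (simp add: node_darts_simps)
qed

text \<open>
  A coloring of one tangle of a move can be replaced by a coloring of the other tangle without
  changing the boundary. The inner colors of the new tangle are forced, and the
  witnesses below are these forced values; that they satisfy the rules is the algebraic content of the
  move. For the witness to leave the boundary colors alone, the inner edges must differ from each
  other and from the boundary edges, which follows from the distinctness of the ends.
\<close>

lemma local_move_extends_forward:
  assumes "local_move B L L'" "distinct (tangle_darts L')" "\<forall>v \<in> set L. colored c v"
  shows "\<exists>c'. (\<forall>v \<in> set L'. colored c' v) \<and> (\<forall>e \<in> B. c' e = c e)"
  using assms
proof (induction rule: local_move.induct)
  case (I_over_right x y m)
  then show ?case
    by (intro exI[of _ "c(m := c x)"]) (auto simp: colored_simps tri_idem)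
next
  case (I_over_left x y m)
  then show ?case
    by (intro exI[of _ "c(m := c x)"]) (auto simp: colored_simps tri_idem)
next
  case (I_under_right x y m)
  then show ?case
    by (intro exI[of _ "c(m := c x)"]) (auto simp: colored_simps tri_idem)
next
  case (I_under_left x y m)
  then show ?case
    by (intro exI[of _ "c(m := c x)"]) (auto simp: colored_simps tri_idem)
next
  case (II b1 t1 b2 t2 p q m k)
  have "m \<noteq> k \<and> m \<notin> {b1, t1, b2, t2} \<and> k \<notin> {b1, t1, b2, t2}"
    using II.prems(1) by (simp add: node_darts_simps) (cases p; cases q; auto)
  then show ?case using II.prems(2)
    by (intro exI[of _ "c(m := c b1, k := act p (c b2) (c b1))"])
      (auto simp: colored_simps act_closed)
next
  case (III_up t0 t2 m0 m2 b0 b2 t m t1 m1 b b1 m1' b1' t1')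
  have "distinct [t1', m1', b1'] \<and> {t1', m1', b1'} \<inter> {t0, t2, m0, m2, b0, b2} = {}"
    using III_up.prems(1) by (simp add: node_darts_simps) (cases t; cases m; cases b; auto)
  then show ?case using III_up.prems(2) act_distrib[of "c b2" "c m1" "c t0" t m]
    by (intro exI[of _ "c(t1' := c t0, m1' := c m0, b1' := act t (c b2) (c t0))"])
      (auto simp: colored_simps act_closed)
next
  case (III_down t0 t2 m0 m2 b0 b2 t b t1 b1 m m1 m1' b1' t1')
  have "distinct [t1', m1', b1'] \<and> {t1', m1', b1'} \<inter> {t0, t2, m0, m2, b0, b2} = {}"
    using III_down.prems(1) by (simp add: node_darts_simps) (cases t; cases m; cases b; auto)
  then show ?case using III_down.prems(2) act_distrib[of "c b2" "c m2" "c t0" t "\<not> m"]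
    by (intro exI[of _ "c(t1' := c t0, m1' := c m0, b1' := act t (c b2) (c t0))"])
      (auto simp: colored_simps act_closed)
next
  case (IV v k1 o1 x2 o2 x3 o3 v' x1 k2 k3 s0 s2 u s1)
  have "distinct [k2, k3, s1] \<and> {k2, k3, s1} \<inter> {x1, x2, x3, s0, s2} = {}"
    using IV.prems(1) IV.hyps(2)
    by (simp add: node_darts_simps) (cases o1; cases o2; cases o3; cases u; auto)
  then show ?case using IV.prems(2) IV.hyps
    by (intro exI[of _ "c(k2 := c x2, k3 := c x3, s1 := act o2 (c s0) (c x2))"])
      (auto simp: colored_simps act_closed vertex_relation_slide)
next
  case (V_first v x1 o1 x2 o2 x3 o3 v' k2 k1)
  have "k1 \<noteq> k2 \<and> {k1, k2} \<inter> {x1, x2, x3} = {}"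
    using V_first.prems(1) V_first.hyps(2)
    by (simp add: node_darts_simps) (cases o1; cases o2; cases o3; auto)
  then show ?case using V_first.prems(2) V_first.hyps
    by (intro exI[of _ "c(k1 := c x1, k2 := act (\<not> o1) (c x2) (c x1))"])
      (auto simp: colored_simps act_closed act_cancel' vertex_relation_twist_first)
next
  case (V_second v x1 o1 x2 o2 x3 o3 v' k2 k1)
  have "k1 \<noteq> k2 \<and> {k1, k2} \<inter> {x1, x2, x3} = {}"
    using V_second.prems(1) V_second.hyps(2)
    by (simp add: node_darts_simps) (cases o1; cases o2; cases o3; auto)
  then show ?case using V_second.prems(2) V_second.hyps
    by (intro exI[of _ "c(k2 := c x2, k1 := act o2 (c x1) (c x2))"])
      (auto simp: colored_simps act_closed vertex_relation_twist_second)
next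
  case (VI v k1 o1 x2 o2 x3 o3 v' x1 k2 k3 s0 s2 u s1)
  have "distinct [k2, k3, s1] \<and> {k2, k3, s1} \<inter> {x1, x2, x3, s0, s2} = {}"
    using VI.prems(1) VI.hyps(2)
    by (simp add: node_darts_simps) (cases o1; cases o2; cases o3; cases u; auto)
  then show ?case using VI.prems(2) VI.hyps
    by (intro exI[of _ "c(k2 := act u (c x2) (c s0), k3 := act u (c x3) (c s0), s1 := c s0)"])
      (auto simp: colored_simps act_closed vertex_relation_act)
qed

lemma local_move_extends_backward:
  assumes "local_move B L L'" "distinct (tangle_darts L)" "\<forall>v \<in> set L'. colored c v"
  shows "\<exists>c'. (\<forall>v \<in> set L. colored c' v) \<and> (\<forall>e \<in> B. c' e = c e)"
  using assms
proof (induction rule: local_move.induct)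
  case (I_over_right x y m)
  then show ?case by (intro exI[of _ c]) (auto simp: colored_simps tri_idem)
next
  case (I_over_left x y m)
  then show ?case by (intro exI[of _ c]) (auto simp: colored_simps, metis inv_tri tri_idem)
next
  case (I_under_right x y m)
  then show ?case by (intro exI[of _ c]) (auto simp: colored_simps, metis inv_tri tri_idem)
next
  case (I_under_left x y m)
  then show ?case by (intro exI[of _ c]) (auto simp: colored_simps tri_idem)
next
  case (II b1 t1 b2 t2 p q m k)
  then show ?case by (intro exI[of _ c]) (auto simp: colored_simps act_inject)
next
  case (III_up t0 t2 m0 m2 b0 b2 t m t1 m1 b b1 m1' b1' t1')
  have "distinct [t1, m1, b1] \<and> {t1, m1, b1} \<inter> {t0, t2, m0, m2, b0, b2} = {}"
    using III_up.prems(1) by (simp add: node_darts_simps) (cases t; cases m; cases b; auto)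
  then show ?case using III_up.prems(2) act_distrib[of "c b2" "c m2" "c t0" t m]
    by (intro exI[of _ "c(t1 := c t0, m1 := c m2, b1 := act m (c b2) (c m2))"])
      (auto simp: colored_simps act_closed)
next
  case (III_down t0 t2 m0 m2 b0 b2 t b t1 b1 m m1 m1' b1' t1')
  have "distinct [t1, m1, b1] \<and> {t1, m1, b1} \<inter> {t0, t2, m0, m2, b0, b2} = {}"
    using III_down.prems(1) by (simp add: node_darts_simps) (cases t; cases m; cases b; auto)
  then show ?case using III_down.prems(2) act_distrib[of "c b2" "c m2" "c t0" t "\<not> m"]
    by (intro exI[of _ "c(t1 := c t0, m1 := c m2, b1 := act (\<not> m) (c b2) (c m2))"])
      (auto simp: colored_simps act_closed)
next
  case (IV v k1 o1 x2 o2 x3 o3 v' x1 k2 k3 s0 s2 u s1)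
  have "k1 \<notin> {x1, x2, x3, s0, s2}"
    using IV.prems(1) IV.hyps(1)
    by (simp add: node_darts_simps) (cases o1; cases o2; cases o3; cases u; auto)
  then show ?case using IV.prems(2) IV.hyps
    by (intro exI[of _ "c(k1 := c x1)"])
      (auto simp: colored_simps act_closed vertex_relation_slide)
next
  case (V_first v x1 o1 x2 o2 x3 o3 v' k2 k1)
  then show ?case
    by (intro exI[of _ c])
      (auto simp: colored_simps act_closed act_cancel vertex_relation_twist_first[symmetric])
next
  case (V_second v x1 o1 x2 o2 x3 o3 v' k2 k1)
  then show ?case
    by (intro exI[of _ c]) (auto simp: colored_simps act_closed vertex_relation_twist_second)
next
  case (VI v k1 o1 x2 o2 x3 o3 v' x1 k2 k3 s0 s2 u s1)
  have "k1 \<notin> {x1, x2, x3, s0, s2}"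
    using VI.prems(1) VI.hyps(1)
    by (simp add: node_darts_simps) (cases o1; cases o2; cases o3; cases u; auto)
  moreover have "vertex_relation o1 (act (\<not> u) (c x1) (c s0)) o2 (c x2) o3 (c x3)"
    using VI.prems(2) VI.hyps
      vertex_relation_act[of "act (\<not> u) (c x1) (c s0)" "c x2" "c x3" "c s0" o1 u o2 o3]
    by (auto simp: colored_simps act_closed act_cancel')
  ultimately show ?case using VI.prems(2) VI.hyps
    by (intro exI[of _ "c(k1 := act (\<not> u) (c x1) (c s0))"])
      (auto simp: colored_simps act_closed act_cancel')
qed

lemma tangle_move_extends:
  assumes "tangle_move B L L'" "distinct (tangle_darts L')" "\<forall>v \<in> set L. colored c v"
  shows "\<exists>c'. (\<forall>v \<in> set L'. colored c' v) \<and> (\<forall>e \<in> B. c' e = c e)"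
  using assms(1) unfolding tangle_move_def
proof
  assume "local_move B L L'"
  then show ?thesis by (rule local_move_extends_forward[OF _ assms(2,3)])
next
  assume "local_move B L' L"
  then show ?thesis by (rule local_move_extends_backward[OF _ assms(2,3)])
qed

lemma tangle_move_unique:
  assumes "tangle_move B L L'" "\<forall>v \<in> set L'. colored c v" "\<forall>v \<in> set L'. colored c' v"
    and "\<forall>e \<in> B. c e = c' e"
  shows "\<forall>e \<in> fst ` set (tangle_darts L'). c e = c' e"
  using assms(1) unfolding tangle_move_def
proof
  assume "local_move B L L'"
  then show ?thesis by (rule local_move_unique_right[OF _ assms(2-4)])
next
  assume "local_move B L' L"
  then show ?thesis by (rule local_move_unique_left[OF _ assms(2-4)])
qed

text \<open>
  Outside the ball the given coloring is kept, inside it is replaced by the coloring of the new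
  tangle. The two choices do not interfere, since inner edges do not occur outside.
\<close>

theorem qualgebra_rules_topological: "topological Q (qualgebra_rules tri dia)"
  unfolding topological_iff_edge_colorings
proof (intro allI impI, elim conjE)
  fix D D' out c assume move: "R_move D D' out" and c: "edge_coloring Q tri dia D c"
  obtain B L L' N where B: "tangle_move B L L'"
    and nodes: "set (nodes D) = set L \<union> set N" "set (nodes D') = set L' \<union> set N"
    and bd: "boundary D' = boundary D"
    and out: "out = B \<union> fst ` set (boundary D) \<union> (\<Union>v\<in>set N. node_edges v)"
    and distinct: "distinct (boundary D' @ tangle_darts L' @ tangle_darts N)"
    by (rule R_moveE[OF move])
  have cL: "\<forall>v \<in> set L. colored c v" and cN: "\<forall>v \<in> set N. colored c v"
    and cbd: "c ` fst ` set (boundary D) \<subseteq> Q"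
    using c nodes by (auto simp: edge_coloring_def)
  obtain c' where c': "\<forall>v \<in> set L'. colored c' v" "\<forall>e \<in> B. c' e = c e"
    using tangle_move_extends[OF B _ cL] distinct by (auto simp only: distinct_append)
  define d where "d e = (if e \<in> out then c e else c' e)" for e
  have d_inside: "d e = c' e" if v: "v \<in> set L'" "e \<in> node_edges v" for v e
  proof (cases "e \<in> B")
    case True
    then show ?thesis using c' by (simp add: d_def)
  next
    case False
    have "e \<in> fst ` set (tangle_darts L')" using v by auto
    then have "(e, b) \<in> set (tangle_darts L')" for b
      using tangle_move_internal[OF B] False by blast
    then have "(e, b) \<notin> set (boundary D) \<and> (e, b) \<notin> set (tangle_darts N)" for b
      using distinct bd by auto
    then have "e \<notin> out" using False out by auto
    then show ?thesis by (simp add: d_def)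
  qed
  have dL': "\<forall>v \<in> set L'. colored d v"
  proof
    fix v assume v: "v \<in> set L'"
    have "colored d v \<longleftrightarrow> colored c' v" by (rule node_colored_cong) (rule d_inside[OF v])
    then show "colored d v" using c'(1) v by blast
  qed
  have d_outside: "d e = c e" if "v \<in> set N" "e \<in> node_edges v" for v e
    using that by (auto simp: d_def out)
  have dN: "\<forall>v \<in> set N. colored d v"
  proof
    fix v assume v: "v \<in> set N"
    have "colored d v \<longleftrightarrow> colored c v" by (rule node_colored_cong) (rule d_outside[OF v])
    then show "colored d v" using cN v by blast
  qed
  have "d ` fst ` set (boundary D') = c ` fst ` set (boundary D)"
    unfolding bd by (rule image_cong) (auto simp: d_def out)
  then have d: "edge_coloring Q tri dia D' d"
    unfolding edge_coloring_def nodes ball_Un using dL' dN cbd by simp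
  have unique: "c1 e = c2 e"
    if "edge_coloring Q tri dia D' c1" "edge_coloring Q tri dia D' c2"
      "\<forall>e \<in> out. c1 e = c e" "\<forall>e \<in> out. c2 e = c e" "e \<in> edges D'" for c1 c2 e
  proof -
    have inside: "\<forall>e \<in> fst ` set (tangle_darts L'). c1 e = c2 e"
    proof (rule tangle_move_unique[OF B])
      show "\<forall>v \<in> set L'. colored c1 v" "\<forall>v \<in> set L'. colored c2 v"
        using that(1,2) unfolding edge_coloring_def nodes ball_Un by simp_all
      show "\<forall>e \<in> B. c1 e = c2 e" using that(3,4) unfolding out by simp
    qed
    have "e \<in> fst ` set (tangle_darts L') \<or> e \<in> out"
      using that(5) unfolding edges_eq nodes bd out by (auto simp: image_UN)
    then show ?thesis
    proof
      assume "e \<in> out"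
      then show ?thesis using that(3,4) by simp
    qed (rule inside[rule_format])
  qed
  show "\<exists>c'. edge_coloring Q tri dia D' c' \<and> (\<forall>e \<in> out. c' e = c e) \<and>
      (\<forall>c''. edge_coloring Q tri dia D' c'' \<and> (\<forall>e \<in> out. c'' e = c e) \<longrightarrow>
        (\<forall>e \<in> edges D'. c'' e = c' e))"
  proof (intro exI[of _ d] conjI allI impI ballI)
    show "d e = c e" if "e \<in> out" for e using that by (simp add: d_def)
    show "c'' e = d e"
      if "edge_coloring Q tri dia D' c'' \<and> (\<forall>e \<in> out. c'' e = c e)" "e \<in> edges D'" for c'' e
      by (rule unique[OF _ d]) (use that in \<open>simp_all add: d_def\<close>)
  qed (rule d)
qed

end

section \<open>A criterion for planarity\<close>

text \<open>
  If \<open>f\<close> runs cyclically through a list, then the orbit is the list. Both the vertices and the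
  faces of a map are orbits of this kind, so both can be counted by listing cycles.
\<close>

lemma orbit_eq_cycle:
  assumes "map f xs = rotate1 xs" and "x \<in> set xs"
  shows "orbit f x = set xs"
proof -
  let ?n = "length xs"
  have n: "?n > 0" using assms(2) by (cases xs) auto
  have step: "f (xs ! i) = xs ! (Suc i mod ?n)" if "i < ?n" for i
    using arg_cong[OF assms(1), of "\<lambda>ys. ys ! i"] that by (simp add: nth_rotate1)
  have iter: "(f ^^ k) (xs ! i) = xs ! ((i + k) mod ?n)" if "i < ?n" for i k
  proof (induction k)
    case (Suc k)
    then show ?case using step[of "(i + k) mod ?n"] n by (simp add: mod_Suc_eq)
  qed (use that in simp)
  obtain i where i: "i < ?n" "x = xs ! i" using assms(2) by (auto simp: in_set_conv_nth)
  show ?thesis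
  proof
    show "orbit f x \<subseteq> set xs" using i n by (auto simp: orbit_altdef iter)
    show "set xs \<subseteq> orbit f x"
    proof
      fix y assume "y \<in> set xs"
      then obtain j where j: "j < ?n" "y = xs ! j" by (auto simp: in_set_conv_nth)
      have "(f ^^ (j + ?n - i)) x = y" using i j by (simp add: iter)
      moreover have "0 < j + ?n - i" using i by simp
      ultimately show "y \<in> orbit f x" unfolding orbit_altdef by blast
    qed
  qed
qed

lemma card_orbits_eq_cycles:
  assumes "distinct (concat F)" "[] \<notin> set F" "\<forall>xs \<in> set F. map f xs = rotate1 xs"
  shows "card (orbit f ` set (concat F)) = length F"
proof -
  have "orbit f ` set (concat F) = set (map set F)"
  proof
    show "orbit f ` set (concat F) \<subseteq> set (map set F)"
      using assms(3) orbit_eq_cycle by fastforce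
    have "set xs \<in> orbit f ` set (concat F)" if xs: "xs \<in> set F" for xs
    proof -
      have "xs \<noteq> []" using xs assms(2) by metis
      then have "hd xs \<in> set xs" by simp
      then show ?thesis using xs assms(3) orbit_eq_cycle[of f xs "hd xs"] by force
    qed
    then show "set (map set F) \<subseteq> orbit f ` set (concat F)" by auto
  qed
  moreover have "distinct (map set F)"
  proof -
    have "inj_on set (set F)"
    proof (rule inj_onI)
      fix xs ys assume "xs \<in> set F" "ys \<in> set F" "set xs = set ys"
      then show "xs = ys" using assms(1,2) unfolding distinct_concat_iff
        by (metis inf.idem set_empty2)
    qed
    then show ?thesis using assms(1,2) by (simp add: distinct_map distinct_concat_iff)
  qed
  ultimately show ?thesis by (metis distinct_card length_map)
qed

text \<open>
  Cycles with disjoint supports do not disturb each other, so their product rotates each of them.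
\<close>

lemma foldr_cycles:
  assumes "distinct (concat F)"
  shows "x \<notin> set (concat F) \<Longrightarrow> foldr (\<circ>) (map cycle_of_list F) id x = x"
    and "xs \<in> set F \<Longrightarrow> map (foldr (\<circ>) (map cycle_of_list F) id) xs = rotate1 xs"
  using assms
proof (induction F arbitrary: x xs)
  case (Cons ys F)
  define R where "R = foldr (\<circ>) (map cycle_of_list F) id"
  have unfold: "foldr (\<circ>) (map cycle_of_list (ys # F)) id = cycle_of_list ys \<circ> R"
    by (simp add: R_def)
  have fixed: "R y = y" if "y \<notin> set (concat F)" "distinct (concat (ys # F))" for y
    unfolding R_def by (rule Cons.IH(1)) (use that in auto)
  {
    case 1
    then show ?case unfolding unfold by (simp add: fixed id_outside_supp)
  next
    case 2
    show ?case unfolding unfold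
    proof (cases "xs = ys")
      case True
      have "R y = y" if "y \<in> set ys" for y
        by (rule fixed) (use 2 that in auto)
      then have "map (cycle_of_list ys \<circ> R) ys = map (cycle_of_list ys) ys" by simp
      also have "\<dots> = rotate1 ys" using cyclic_rotation[of ys 1] 2 by simp
      finally show "map (cycle_of_list ys \<circ> R) xs = rotate1 xs" using True by simp
    next
      case False
      then have xs: "xs \<in> set F" using 2 by simp
      have R: "map R xs = rotate1 xs" unfolding R_def by (rule Cons.IH(2)[OF xs]) (use 2 in simp)
      have "cycle_of_list ys (R y) = R y" if y: "y \<in> set xs" for y
      proof (rule id_outside_supp)
        have "R y \<in> set (map R xs)" using y by simp
        then have "R y \<in> set xs" unfolding R by simp
        then show "R y \<notin> set ys" using xs 2 by auto
      qed
      then have "map (cycle_of_list ys \<circ> R) xs = map R xs" by simp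
      then show "map (cycle_of_list ys \<circ> R) xs = rotate1 xs" using R by simp
    qed
  }
qed simp_all

lemma map_rotation:
  assumes "distinct (concat (vertex_cycles D))" "xs \<in> set (vertex_cycles D)"
  shows "map (rotation D) xs = rotate1 xs"
  unfolding rotation_def using foldr_cycles(2)[OF assms] .

lemma orbit_subset_rtrancl: "orbit f x \<subseteq> {(x, y). y = f x \<or> P x y}\<^sup>* `` {x}"
proof
  fix y assume "y \<in> orbit f x"
  then show "y \<in> {(x, y). y = f x \<or> P x y}\<^sup>* `` {x}"
    by induction (auto intro: rtrancl_into_rtrancl)
qed

lemma opposite_opposite: "opposite (opposite d) = d"
  by (simp add: opposite_def)

text \<open>
  If every node is joined to the boundary circle by an edge, the map is connected: the rotation
  leads from any dart at the node to the one on that edge, and the opposite end of the edge belongs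
  to the exterior vertex.
\<close>

lemma components_eq_darts:
  assumes distinct: "distinct (concat (vertex_cycles D))"
    and opposite: "opposite ` darts D = darts D"
    and boundary: "boundary D \<noteq> []"
    and meets: "\<forall>v \<in> set (nodes D). \<exists>d \<in> set (node_darts v). opposite d \<in> set (boundary D)"
  shows "components D = {darts D}"
proof -
  let ?R = "{(x, y). y = rotation D x \<or> y = opposite x}"
  have rotation: "rotation D x \<in> darts D" if x: "x \<in> darts D" for x
  proof -
    obtain xs where xs: "xs \<in> set (vertex_cycles D)" "x \<in> set xs"
      using x by (auto simp: darts_def)
    then have "rotation D x \<in> set (map (rotation D) xs)" by simp
    then show ?thesis using xs(1) map_rotation[OF distinct xs(1)] by (auto simp: darts_def)
  qed
  have closed: "y \<in> darts D" if "(x, y) \<in> ?R\<^sup>*" "x \<in> darts D" for x y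
    using that by (induction rule: rtrancl_induct) (use rotation opposite in auto)
  have cycle: "(x, y) \<in> ?R\<^sup>*" if "xs \<in> set (vertex_cycles D)" "x \<in> set xs" "y \<in> set xs" for x y xs
    using orbit_subset_rtrancl[of "rotation D" x "\<lambda>x y. y = opposite x"]
      orbit_eq_cycle[OF map_rotation[OF distinct that(1)] that(2)] that(3) by auto
  have opp: "(x, opposite x) \<in> ?R\<^sup>*" for x by auto
  obtain b where b: "b \<in> set (boundary D)" using boundary by (cases "boundary D") auto
  have near: "(x, b) \<in> ?R\<^sup>* \<and> (b, x) \<in> ?R\<^sup>*" if x: "x \<in> darts D" for x
  proof -
    have bd: "(y, z) \<in> ?R\<^sup>*" if "y \<in> set (boundary D)" "z \<in> set (boundary D)" for y z
      using cycle[of "rev (boundary D)"] that by (simp add: vertex_cycles_def)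
    consider "x \<in> set (boundary D)" | v where "v \<in> set (nodes D)" "x \<in> set (node_darts v)"
      using x by (auto simp: darts_def vertex_cycles_def)
    then show ?thesis
    proof cases
      case 1
      then show ?thesis using bd b by blast
    next
      case 2
      then obtain d where d: "d \<in> set (node_darts v)" "opposite d \<in> set (boundary D)"
        using meets by blast
      have "node_darts v \<in> set (vertex_cycles D)" using 2 by (simp add: vertex_cycles_def)
      then have "(x, d) \<in> ?R\<^sup>*" "(d, x) \<in> ?R\<^sup>*" using cycle 2 d by blast+
      moreover have "(d, opposite d) \<in> ?R\<^sup>*" "(opposite d, d) \<in> ?R\<^sup>*"
        using opp[of d] opp[of "opposite d"] by (simp_all add: opposite_opposite)
      moreover have "(opposite d, b) \<in> ?R\<^sup>*" "(b, opposite d) \<in> ?R\<^sup>*" using bd b d by blast+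
      ultimately show ?thesis by (meson rtrancl_trans)
    qed
  qed
  have "?R\<^sup>* `` {x} = darts D" if x: "x \<in> darts D" for x
    using closed[OF _ x] near[OF x] near by (blast intro: rtrancl_trans)
  moreover have "b \<in> darts D" using b by (simp add: darts_def vertex_cycles_def)
  ultimately show ?thesis unfolding components_def by auto
qed

text \<open>
  A corner is a pair of cyclically consecutive entries in one of the lists. The corners of the vertex
  cycles are the graph of the rotation; this makes the rotation accessible to the simplifier
  without evaluating a product of transpositions.
\<close>

definition corners :: "dart list list \<Rightarrow> (dart \<times> dart) list" where
  "corners F = concat (map (\<lambda>xs. zip xs (rotate1 xs)) F)"

lemma rotation_corner:
  assumes "distinct (concat (vertex_cycles D))" "(x, y) \<in> set (corners (vertex_cycles D))"
  shows "rotation D x = y"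
proof -
  obtain xs where xs: "xs \<in> set (vertex_cycles D)" "(x, y) \<in> set (zip xs (rotate1 xs))"
    using assms(2) by (auto simp: corners_def)
  have "zip xs (rotate1 xs) = map (\<lambda>x. (x, rotation D x)) xs"
    by (simp add: zip_map2 zip_same_conv_map flip: map_rotation[OF assms(1) xs(1)])
  then show ?thesis using xs(2) by auto
qed

text \<open>
  The list \<open>F\<close> is a certificate: its entries are the faces, each given by the darts met along it.
  The matching of corners forces them to be darts of the map, and the equality of the total
  lengths then ensures that every dart is covered. As the map is connected, Euler's formula
  becomes a comparison of lengths.
\<close>

lemma is_diagramI:
  assumes distinct: "distinct (concat (vertex_cycles D))"
    and opposite: "\<forall>d \<in> set (concat (vertex_cycles D)). opposite d \<in> set (concat (vertex_cycles D))"
    and boundary: "boundary D \<noteq> []"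
    and meets: "\<forall>v \<in> set (nodes D). \<exists>d \<in> set (node_darts v). opposite d \<in> set (boundary D)"
    and faces: "distinct (concat F)" "[] \<notin> set F"
      "length (concat F) = length (concat (vertex_cycles D))"
      "\<forall>(d, d') \<in> set (corners F). (opposite d, d') \<in> set (corners (vertex_cycles D))"
    and euler: "2 * (length (nodes D) + length F) = length (concat (vertex_cycles D)) + 2"
  shows "is_diagram D"
proof -
  let ?n = "length (concat (vertex_cycles D))"
  have finite: "finite (darts D)" and card_darts: "card (darts D) = ?n"
    unfolding darts_def by (simp, rule distinct_card[OF distinct])
  have opposite': "opposite ` darts D = darts D"
  proof
    show "opposite ` darts D \<subseteq> darts D" using opposite by (auto simp: darts_def)
    then show "darts D \<subseteq> opposite ` darts D"
      by (metis image_eqI image_subset_iff opposite_opposite subsetI)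
  qed
  have face_cycle: "map (rotation D \<circ> opposite) xs = rotate1 xs" if xs: "xs \<in> set F" for xs
  proof (rule nth_equalityI)
    fix i assume i: "i < length (map (rotation D \<circ> opposite) xs)"
    then have "(xs ! i, rotate1 xs ! i) \<in> set (zip xs (rotate1 xs))" by (auto simp: set_zip)
    then have "(xs ! i, rotate1 xs ! i) \<in> set (corners F)" using xs by (auto simp: corners_def)
    then have "(opposite (xs ! i), rotate1 xs ! i) \<in> set (corners (vertex_cycles D))"
      using faces(4) by blast
    then show "map (rotation D \<circ> opposite) xs ! i = rotate1 xs ! i"
      using rotation_corner[OF distinct] i by simp
  qed simp
  have "set (concat F) \<subseteq> darts D"
  proof
    fix d assume "d \<in> set (concat F)"
    then obtain xs where xs: "xs \<in> set F" "d \<in> set xs" by auto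
    then obtain d' where "(d, d') \<in> set (zip xs (rotate1 xs))"
      by (metis in_set_impl_in_set_zip1 length_rotate1)
    then have "(d, d') \<in> set (corners F)" using xs(1) by (auto simp: corners_def)
    then have "(opposite d, d') \<in> set (corners (vertex_cycles D))" using faces(4) by auto
    then have "opposite d \<in> darts D"
      by (auto simp: corners_def darts_def dest: set_zip_leftD)
    then show "d \<in> darts D" using opposite' by (metis image_eqI opposite_opposite)
  qed
  then have "set (concat F) = darts D"
    using finite faces(3) card_darts distinct_card[OF faces(1)] by (intro card_subset_eq) auto
  then have "card (face_orbits D) = length F"
    unfolding face_orbits_def using card_orbits_eq_cycles[OF faces(1,2)] face_cycle by metis
  moreover have "node_darts v \<noteq> []" for v by (cases v) auto
  then have "[] \<noteq> node_darts v" for v by metis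
  then have "[] \<notin> set (vertex_cycles D)"
    using boundary by (auto simp: vertex_cycles_def)
  then have "card (vertex_orbits D) = length (vertex_cycles D)"
    unfolding vertex_orbits_def darts_def
    by (rule card_orbits_eq_cycles[OF distinct]) (simp add: map_rotation[OF distinct])
  moreover have "card (components D) = 1"
    using components_eq_darts[OF distinct opposite' boundary meets] by simp
  moreover have "?n = 2 * card (edges D)"
  proof -
    have "darts D = edges D \<times> UNIV"
    proof
      show "darts D \<subseteq> edges D \<times> UNIV" by (force simp: edges_def)
      show "edges D \<times> UNIV \<subseteq> darts D"
      proof clarify
        fix e b assume "e \<in> edges D"
        then obtain b' where b': "(e, b') \<in> darts D" by (auto simp: edges_def)
        then have "opposite (e, b') \<in> darts D" using opposite' by auto
        then show "(e, b) \<in> darts D" using b' by (cases b; cases b') (auto simp: opposite_def)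
      qed
    qed
    then show ?thesis using card_darts by (simp add: card_cartesian_product)
  qed
  ultimately have "spherical D"
    using euler by (simp add: spherical_def vertex_cycles_def)
  then show ?thesis using distinct opposite' by (simp add: is_diagram_def)
qed

lemmas diagram_simps = vertex_cycles_def corners_def opposite_def

section \<open>Topological coloring rules force the qualgebra axioms\<close>

abbreviation disc :: "node list \<Rightarrow> dart list \<Rightarrow> diagram" where
  "disc L bd \<equiv> \<lparr>nodes = L, boundary = bd\<rparr>"

lemma R_move_disc:
  assumes "tangle_move B L L'" "is_diagram (disc L bd)" "is_diagram (disc L' bd)"
  shows "R_move (disc L bd) (disc L' bd) (B \<union> fst ` set bd)"
  unfolding R_move_def using assms
  by (intro conjI exI[of _ B] exI[of _ L] exI[of _ L'] exI[of _ "[]"])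
    (simp_all add: tangle_move_def)

text \<open>
  Existence and uniqueness for a disc that contains only the tangle of the move.
\<close>

lemma topological_extends:
  assumes "topological Q (qualgebra_rules tri dia)" "tangle_move B L L'"
    and "is_diagram (disc L bd)" "is_diagram (disc L' bd)"
    and "edge_coloring Q tri dia (disc L bd) c"
  shows "\<exists>c'. edge_coloring Q tri dia (disc L' bd) c' \<and> (\<forall>e \<in> B. c' e = c e)"
proof -
  note ext = assms(1)[unfolded topological_iff_edge_colorings, rule_format,
      OF conjI[OF R_move_disc[OF assms(2-4)] assms(5)]]
  show ?thesis by (rule exE[OF ext], elim conjE, intro exI conjI) auto
qed

lemma topological_unique:
  assumes "topological Q (qualgebra_rules tri dia)" "tangle_move B L L'"
    and "is_diagram (disc L bd)" "is_diagram (disc L' bd)"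
    and "edge_coloring Q tri dia (disc L bd) c"
    and "edge_coloring Q tri dia (disc L' bd) c1" "\<forall>e \<in> B \<union> fst ` set bd. c1 e = c e"
    and "edge_coloring Q tri dia (disc L' bd) c2" "\<forall>e \<in> B \<union> fst ` set bd. c2 e = c e"
    and "e \<in> edges (disc L' bd)"
  shows "c1 e = c2 e"
proof -
  note ext = assms(1)[unfolded topological_iff_edge_colorings, rule_format,
      OF conjI[OF R_move_disc[OF assms(2-4)] assms(5)]]
  obtain c' where "\<forall>c''. edge_coloring Q tri dia (disc L' bd) c'' \<and>
      (\<forall>e \<in> B \<union> fst ` set bd. c'' e = c e) \<longrightarrow> (\<forall>e \<in> edges (disc L' bd). c'' e = c' e)"
    by (rule exE[OF ext]) (elim conjE, rule that)
  from this[rule_format, OF conjI[OF assms(6,7)] assms(10)]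
    this[rule_format, OF conjI[OF assms(8,9)] assms(10)]
  show ?thesis by simp
qed

lemmas concrete_coloring = edge_coloring_def node_colored_def

text \<open>
  In the following pictures the edges \<open>0\<close>, \<open>1\<close>, \<dots> that meet the circle come first, and the inner edges
  of the tangles bear the remaining numbers.
\<close>

lemma kink_diagrams:
  fixes bd defines "bd \<equiv> [(0, True), (1, False)]"
  shows "is_diagram (disc [Joint 0 1] bd)"
    "is_diagram (disc [Crossing True 0 2 2 1] bd)"
  unfolding bd_def
  subgoal by (rule is_diagramI[where F =
    "[[(1, False), (0, False)], [(0, True), (1, True)]]"])
    (simp_all add: diagram_simps)
  subgoal by (rule is_diagramI[where F =
    "[[(1, False), (0, False)], [(0, True), (2, False), (1, True)], [(2, True)]]"])
    (simp_all add: diagram_simps)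
  done

lemma topological_imp_idempotent:
  assumes "topological Q (qualgebra_rules tri dia)" and "a \<in> Q"
  shows "tri a a = a"
proof -
  have move: "tangle_move {0, 1} [Joint 0 1] [Crossing True 0 2 2 1]"
    unfolding tangle_move_def using local_move.I_over_right by blast
  have "edge_coloring Q tri dia (disc [Joint 0 1] [(0, True), (1, False)]) (\<lambda>_. a)"
    using assms(2) by (simp add: concrete_coloring)
  from topological_extends[OF assms(1) move kink_diagrams this]
  show ?thesis by (auto simp: concrete_coloring)
qed

lemma bigon_diagrams:
  fixes bd defines "bd \<equiv> [(0, False), (2, True), (3, False), (1, True)]"
  shows "is_diagram (disc [Joint 1 0, Joint 2 3] bd)"
    "is_diagram (disc [Crossing False 4 0 5 2, Crossing True 1 4 5 3] bd)"
  unfolding bd_def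
  subgoal by (rule is_diagramI[where F =
    "[[(1, True), (0, True)], [(3, False), (2, False), (0, False), (1, False)],
    [(2, True), (3, True)]]"])
    (simp_all add: diagram_simps)
  subgoal by (rule is_diagramI[where F =
    "[[(1, True), (5, False), (0, True)], [(3, False), (1, False)],
    [(2, True), (4, False), (3, True)], [(0, False), (2, False)], [(5, True), (4, True)]]"])
    (simp_all add: diagram_simps)
  done

text \<open>
  The second strand is pushed under the first one, which runs downwards and has color \<open>x\<close>. The color
  \<open>k\<close> of the part between the two crossings then lies to the right of the over-strand, so it solves
  \<open>tri k x = y\<close>. Every solution gives an extension of the same coloring, whence uniqueness.
\<close>

lemma topological_imp_bijective:
  assumes "topological Q (qualgebra_rules tri dia)" and "x \<in> Q" "y \<in> Q"
  shows "\<exists>!k. k \<in> Q \<and> tri k x = y"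
proof -
  let ?L = "[Joint 1 0, Joint 2 3]"
  let ?L' = "[Crossing False 4 0 5 2, Crossing True 1 4 5 3]"
  let ?bd = "[(0, False), (2, True), (3, False), (1, True)]"
  let ?c = "\<lambda>k e. [x, x, y, y, x, k] ! e"
  have move: "tangle_move {0, 1, 2, 3} ?L ?L'"
    unfolding tangle_move_def using local_move.II[of 0 1 2 3 False True 4 5]
    by (simp add: strand_def cross_def)
  have c: "edge_coloring Q tri dia (disc ?L ?bd) (?c y)"
    using assms(2,3) by (simp add: concrete_coloring)
  from topological_extends[OF assms(1) move bigon_diagrams this]
  have "\<exists>k. k \<in> Q \<and> tri k x = y" by (auto simp: concrete_coloring)
  moreover have "k = k'" if "k \<in> Q \<and> tri k x = y" "k' \<in> Q \<and> tri k' x = y" for k k'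
  proof -
    have "edge_coloring Q tri dia (disc ?L' ?bd) (?c j)" if "j \<in> Q \<and> tri j x = y" for j
      using assms(2,3) that by (simp add: concrete_coloring)
    then have "?c k 5 = ?c k' 5"
      by (intro topological_unique[OF assms(1) move bigon_diagrams c])
        (use that in \<open>simp_all add: edges_eq\<close>)
    then show ?thesis by simp
  qed
  ultimately show ?thesis by blast
qed

lemma triangle_diagrams:
  fixes bd defines "bd \<equiv> [(0, True), (5, False), (3, False), (1, False), (4, True), (2, True)]"
  shows "is_diagram (disc [Crossing False 0 6 7 2, Crossing False 6 1 8 4, Crossing False 7 3 5 8] bd)"
    "is_diagram (disc [Crossing False 2 7 8 4, Crossing False 0 6 5 8, Crossing False 6 1 3 7] bd)"
  unfolding bd_def
  subgoal by (rule is_diagramI[where F =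
    "[[(2, True), (0, False)], [(4, True), (6, False), (2, False)],
    [(1, False), (4, False)], [(3, False), (8, False), (1, True)],
    [(5, False), (3, True)], [(0, True), (7, True), (5, True)],
    [(6, True), (8, True), (7, False)]]"])
    (simp_all add: diagram_simps)
  subgoal by (rule is_diagramI[where F =
    "[[(2, True), (8, True), (0, False)], [(4, True), (2, False)],
    [(1, False), (7, False), (4, False)], [(3, False), (1, True)],
    [(5, False), (6, True), (3, True)], [(0, True), (5, True)],
    [(7, True), (6, False), (8, False)]]"])
    (simp_all add: diagram_simps)
  done

text \<open>
  The strands run northwards and eastwards. The colors \<open>a\<close> and \<open>b\<close> are those of the east ends of the
  bottom and the middle strand, and \<open>c\<close> is the color of the top strand. The west end of the bottom
  strand has the left-hand side as its color before the move and the right-hand side after it.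
\<close>

lemma topological_imp_distrib:
  assumes "topological Q (qualgebra_rules tri dia)" "binary_operation Q tri"
    and "a \<in> Q" "b \<in> Q" "c \<in> Q"
  shows "tri (tri a b) c = tri (tri a c) (tri b c)"
proof -
  let ?L = "[Crossing False 0 6 7 2, Crossing False 6 1 8 4, Crossing False 7 3 5 8]"
  let ?L' = "[Crossing False 2 7 8 4, Crossing False 0 6 5 8, Crossing False 6 1 3 7]"
  let ?bd = "[(0, True), (5, False), (3, False), (1, False), (4, True), (2, True)]"
  let ?c = "\<lambda>e. [c, c, tri b c, b, tri (tri a b) c, a, c, b, tri a b] ! e"
  have move: "tangle_move {0, 1, 2, 3, 4, 5} ?L ?L'"
    unfolding tangle_move_def
    using local_move.III_up[of 0 1 2 3 4 5 True True 6 7 True 8 7 8 6]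
    by (simp add: cross_def)
  have c: "edge_coloring Q tri dia (disc ?L ?bd) ?c"
    using assms(2-) by (simp add: concrete_coloring binary_operation_def)
  obtain c' where c': "edge_coloring Q tri dia (disc ?L' ?bd) c'"
      "\<forall>e \<in> {0, 1, 2, 3, 4, 5}. c' e = ?c e"
    by (rule exE[OF topological_extends[OF assms(1) move triangle_diagrams(1,2) c]])
      (elim conjE, rule that)
  have "c' 4 = tri (tri (c' 5) (c' 0)) (c' 2)"
    using c'(1) by (simp add: concrete_coloring)
  then show ?thesis using c'(2) by simp
qed

lemma strand_under_vertex_diagrams:
  fixes bd defines "bd \<equiv> [(0, True), (3, True), (1, False), (2, False), (4, False)]"
  shows "is_diagram (disc [Unzip 1 2 5, Crossing True 0 5 3 4] bd)"
    "is_diagram (disc [Unzip 5 6 0, Crossing True 5 1 3 7, Crossing True 6 2 7 4] bd)"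
  unfolding bd_def
  subgoal by (rule is_diagramI[where F =
    "[[(4, False), (0, False)], [(2, False), (5, False), (4, True)],
    [(1, False), (2, True)], [(3, True), (5, True), (1, True)], [(0, True), (3, False)]]"])
    (simp_all add: diagram_simps)
  subgoal by (rule is_diagramI[where F =
    "[[(4, False), (6, False), (0, False)], [(2, False), (4, True)],
    [(1, False), (7, True), (2, True)], [(3, True), (1, True)],
    [(0, True), (5, True), (3, False)], [(6, True), (7, False), (5, False)]]"])
    (simp_all add: diagram_simps)
  done

text \<open>
  A strand of color \<open>a\<close> passes under the incoming edge of an unzip vertex before the move, and under
  the two outgoing edges, colored \<open>b\<close> and \<open>c\<close>, after it.
\<close>

lemma topological_imp_act_product:
  assumes "topological Q (qualgebra_rules tri dia)" "binary_operation Q tri" "binary_operation Q dia"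
    and "a \<in> Q" "b \<in> Q" "c \<in> Q"
  shows "tri a (dia b c) = tri (tri a b) c"
proof -
  let ?L = "[Unzip 1 2 5, Crossing True 0 5 3 4]"
  let ?L' = "[Unzip 5 6 0, Crossing True 5 1 3 7, Crossing True 6 2 7 4]"
  let ?bd = "[(0, True), (3, True), (1, False), (2, False), (4, False)]"
  let ?c = "\<lambda>e. [dia b c, b, c, a, tri a (dia b c), dia b c] ! e"
  have move: "tangle_move {0, 1, 2, 3, 4} ?L ?L'"
    unfolding tangle_move_def
    using local_move.IV[of "Unzip 1 2 5" 5 False 1 True 2 True "Unzip 5 6 0" 0 5 6 3 4 True 7]
    by (simp add: cross_def trivalent_rotations)
  have c: "edge_coloring Q tri dia (disc ?L ?bd) ?c"
    using assms(2-) by (simp add: concrete_coloring binary_operation_def)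
  obtain c' where c': "edge_coloring Q tri dia (disc ?L' ?bd) c'"
      "\<forall>e \<in> {0, 1, 2, 3, 4}. c' e = ?c e"
    by (rule exE[OF topological_extends[OF assms(1) move strand_under_vertex_diagrams(1,2) c]])
      (elim conjE, rule that)
  have "c' 4 = tri (tri (c' 3) (c' 1)) (c' 2)"
    using c'(1) by (simp add: concrete_coloring)
  then show ?thesis using c'(2) by simp
qed

lemma strand_over_vertex_diagrams:
  fixes bd defines "bd \<equiv> [(0, True), (3, True), (1, False), (2, False), (4, False)]"
  shows "is_diagram (disc [Unzip 1 2 5, Crossing False 3 4 5 0] bd)"
    "is_diagram (disc [Unzip 5 6 0, Crossing False 3 7 1 5, Crossing False 7 4 2 6] bd)"
  unfolding bd_def
  subgoal by (rule is_diagramI[where F =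
    "[[(4, False), (0, False)], [(2, False), (5, False), (4, True)],
    [(1, False), (2, True)], [(3, True), (5, True), (1, True)], [(0, True), (3, False)]]"])
    (simp_all add: diagram_simps)
  subgoal by (rule is_diagramI[where F =
    "[[(4, False), (6, False), (0, False)], [(2, False), (4, True)],
    [(1, False), (7, True), (2, True)], [(3, True), (1, True)],
    [(0, True), (5, True), (3, False)], [(6, True), (7, False), (5, False)]]"])
    (simp_all add: diagram_simps)
  done

text \<open>
  A strand of color \<open>c\<close> passes over the incoming edge of an unzip vertex before the move, and over
  the two outgoing edges, colored \<open>a\<close> and \<open>b\<close>, after it; the vertex then produces the color of the far
  part of the incoming edge from the translated colors.
\<close>

lemma topological_imp_product_distrib:
  assumes "topological Q (qualgebra_rules tri dia)" "binary_operation Q tri" "binary_operation Q dia"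
    and "a \<in> Q" "b \<in> Q" "c \<in> Q"
  shows "tri (dia a b) c = dia (tri a c) (tri b c)"
proof -
  let ?L = "[Unzip 1 2 5, Crossing False 3 4 5 0]"
  let ?L' = "[Unzip 5 6 0, Crossing False 3 7 1 5, Crossing False 7 4 2 6]"
  let ?bd = "[(0, True), (3, True), (1, False), (2, False), (4, False)]"
  let ?c = "\<lambda>e. [tri (dia a b) c, a, b, c, c, dia a b] ! e"
  have move: "tangle_move {0, 1, 2, 3, 4} ?L ?L'"
    unfolding tangle_move_def
    using local_move.VI[of "Unzip 1 2 5" 5 False 1 True 2 True "Unzip 5 6 0" 0 5 6 3 4 True 7]
    by (simp add: cross_def trivalent_rotations)
  have c: "edge_coloring Q tri dia (disc ?L ?bd) ?c"
    using assms(2-) by (simp add: concrete_coloring binary_operation_def)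
  obtain c' where c': "edge_coloring Q tri dia (disc ?L' ?bd) c'"
      "\<forall>e \<in> {0, 1, 2, 3, 4}. c' e = ?c e"
    by (rule exE[OF topological_extends[OF assms(1) move strand_over_vertex_diagrams(1,2) c]])
      (elim conjE, rule that)
  have "c' 0 = dia (tri (c' 1) (c' 3)) (tri (c' 2) (c' 3))"
    using c'(1) by (simp add: concrete_coloring)
  then show ?thesis using c'(2) by simp
qed

lemma twist_diagrams:
  fixes bd defines "bd \<equiv> [(0, False), (1, False), (2, True)]"
  shows "is_diagram (disc [Unzip 0 1 2] bd)"
    "is_diagram (disc [Unzip 4 3 2, Crossing True 3 0 4 1] bd)"
  unfolding bd_def
  subgoal by (rule is_diagramI[where F =
    "[[(2, True), (0, True)], [(1, False), (2, False)], [(0, False), (1, True)]]"])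
    (simp_all add: diagram_simps)
  subgoal by (rule is_diagramI[where F =
    "[[(2, True), (4, True), (0, True)], [(1, False), (3, False), (2, False)],
    [(0, False), (1, True)], [(3, True), (4, False)]]"])
    (simp_all add: diagram_simps)
  done

text \<open>
  A twist at an unzip vertex is removed: with outgoing edges \<open>a\<close> and \<open>b\<close> at the vertex, the edge \<open>a\<close>
  has passed under \<open>b\<close> when it reaches the boundary, so that the edges there are \<open>b\<close> and \<open>tri a b\<close>.
\<close>

lemma topological_imp_product_swap:
  assumes "topological Q (qualgebra_rules tri dia)" "binary_operation Q tri" "binary_operation Q dia"
    and "a \<in> Q" "b \<in> Q"
  shows "dia a b = dia b (tri a b)"
proof -
  let ?L = "[Unzip 4 3 2, Crossing True 3 0 4 1]"
  let ?L' = "[Unzip 0 1 2]"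
  let ?bd = "[(0, False), (1, False), (2, True)]"
  let ?c = "\<lambda>e. [b, tri a b, dia a b, b, a] ! e"
  have move: "tangle_move {0, 1, 2} ?L ?L'"
    unfolding tangle_move_def
    using local_move.V_first[of "Unzip 0 1 2" 0 True 1 True 2 False "Unzip 4 3 2" 4 3]
    by (simp add: cross_def trivalent_rotations)
  have c: "edge_coloring Q tri dia (disc ?L ?bd) ?c"
    using assms(2-) by (simp add: concrete_coloring binary_operation_def)
  obtain c' where c': "edge_coloring Q tri dia (disc ?L' ?bd) c'"
      "\<forall>e \<in> {0, 1, 2}. c' e = ?c e"
    by (rule exE[OF topological_extends[OF assms(1) move twist_diagrams(2,1) c]])
      (elim conjE, rule that)
  have "c' 2 = dia (c' 0) (c' 1)"
    using c'(1) by (simp add: concrete_coloring)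
  then show ?thesis using c'(2) by simp
qed

theorem proposition3p7:
  fixes Q :: "'q set" and tri dia :: "'q \<Rightarrow> 'q \<Rightarrow> 'q"
  assumes "binary_operation Q tri" and "binary_operation Q dia"
  shows "topological Q (qualgebra_rules tri dia) \<longleftrightarrow> qualgebra Q tri dia"
proof
  assume top: "topological Q (qualgebra_rules tri dia)"
  define inv where "inv y x = (THE k. k \<in> Q \<and> tri k x = y)" for y x
  have inv: "inv y x \<in> Q \<and> tri (inv y x) x = y" if "x \<in> Q" "y \<in> Q" for x y
    unfolding inv_def by (rule theI') (rule topological_imp_bijective[OF top that])
  have closed: "tri x y \<in> Q" if "x \<in> Q" "y \<in> Q" for x y
    using assms(1) that by (simp add: binary_operation_def)
  show "qualgebra Q tri dia"
    unfolding qualgebra_def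
  proof (intro conjI exI[of _ inv] ballI assms)
    show "binary_operation Q inv" using inv by (simp add: binary_operation_def)
    fix a b c assume a: "a \<in> Q" and b: "b \<in> Q" and c: "c \<in> Q"
    show "tri (tri a b) c = tri (tri a c) (tri b c)"
      by (rule topological_imp_distrib[OF top assms(1) a b c])
    show "inv (tri a b) b = a"
      unfolding inv_def
      by (rule the1_equality[OF topological_imp_bijective[OF top b closed[OF a b]]]) (simp add: a)
    show "tri (inv a b) b = a" using inv[OF b a] by simp
    show "tri a a = a" by (rule topological_imp_idempotent[OF top a])
    show "tri a (dia b c) = tri (tri a b) c"
      by (rule topological_imp_act_product[OF top assms a b c])
    show "tri (dia a b) c = dia (tri a c) (tri b c)"
      by (rule topological_imp_product_distrib[OF top assms a b c])
    show "dia a b = dia b (tri a b)" by (rule topological_imp_product_swap[OF top assms a b])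
  qed
next
  assume "qualgebra Q tri dia"
  then obtain inv where "qualgebra_ops Q tri dia inv"
    unfolding qualgebra_def qualgebra_ops_def binary_operation_def by blast
  then interpret qualgebra_ops Q tri dia inv .
  show "topological Q (qualgebra_rules tri dia)" by (rule qualgebra_rules_topological)
qed

end
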